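(* Let $I\subset\mathbb{R}$ be an interval and $\gamma\colon I\cap\mathbb{Z}\to S^4$ a polygon in $S^4=\mathbb{H}\mathbb{P}^1$. A discrete curve $\eta\colon I\cap\mathbb{Z}\to S^4$ is a Darboux transform (as a curve) of $\gamma$ if and only if the thin cylinder in $S^4$ corresponding to $\eta$ is a Darboux transform (as a discrete surface) of the immersed thin cylinder corresponding to $\gamma$. In particular, the spectral curve of a closed polygon $\gamma$ in $S^4$ coincides with the spectral curve of the corresponding thin torus in $S^4$.
   Context: Curves. A discrete curve is a map $\gamma\colon I\cap\mathbb{Z}\to S^4=\mathbb{H}\mathbb{P}^1$; it is a polygon if every three consecutive points are mutually different ($\gamma_n\ne\gamma_{n+1}$ and $\gamma_n\ne\gamma_{n+2}$). Points of $\mathbb{H}\mathbb{P}^1$ are right quaternionic lines in $\mathbb{H}^2$, and $\mathbb{C}=\mathrm{Span}_{\mathbb{R}}\{1,\mathbf{i}\}\subset\mathbb{H}$. A curve $\eta$ is a Darboux transform of $\gamma$ if there is $\lambda\in\mathbb{C}_*$ and a homogeneous lift $\hat\eta$ of $\eta$ to $\mathbb{H}^2$ with $$\hat\eta_{n+1}=P_n\hat\eta_n+Q_n\hat\eta_n\lambda,$$ where $P_n,Q_n$ are the quaternionic linear projections of $\mathbb{H}^2$ to the summands $\gamma_n$ and $\gamma_{n+1}$, respectively, of the splitting $\mathbb{H}^2=\gamma_n\oplus\gamma_{n+1}$; it is understood to be non-degenerate, i.e. $\eta_n\ne\gamma_n$ and $\eta_n\ne\gamma_{n+1}$. Thin cylinders.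 Take one row of black and white triangles of the regular triangulation of the plane, bounded by a lower and an upper line of vertices, and identify the lower left vertex of each black triangle with the upper right vertex of the white triangle to the right of it. Explicitly: vertices are numbered by $n\in I\cap\mathbb{Z}$; the universal covering has vertices $(n,k)$, $k\in\mathbb{Z}$, with the deck transformation $\tau(n,k)=(n,k+1)$; the black triangles are $b_{n,k}=\{(n,k),(n+1,k),(n-1,k+1)\}$ (number $n$, the number of the lower left vertex), the white triangles are $w_{n,k}=\{(n+1,k),(n-1,k+1),(n,k+1)\}$ (number $n$, the number of the upper right vertex), and $w_{n,k}$ shares edges with $b_{n,k}$ (common vertices $(n+1,k),(n-1,k+1)$), $b_{n+1,k}$ (common vertices $(n+1,k),(n,k+1)$) and $b_{n-1,k+1}$ (common vertices $(n-1,k+1),(n,k+1)$). A polygon $\gamma$ is the same as an immersion $f(n)=\gamma_n$ of the thin cylinder $M$, and a curve $\eta$ is regarded as the map $f^\sharp$ on the set of black triangles of $M$ with value $\eta_n$ on the black triangle with number $n$. If $I\ne\mathbb{R}$ the conditions below are imposed for all vertices and triangles whose indices lie in $I\cap\mathbb{Z}$. For a closed polygon of period $n$ one additionally identifies indices modulo $n$ and obtains a thin torus (a discrete torus with regular combinatorics), with group of deck transformations $\Gamma\cong\mathbb{Z}^2$ generated by the horizontal shift by $n$ and by $\tau$. Darboux transforms of discrete surfaces. Let $M$ be a bi-colored triangulated surface, $f\colon M\to\mathbb{H}\mathbb{P}^1$ an immersion (different values at adjacent vertices), $L_v=f(v)\subset\mathbb{H}^2$. A map $f^\sharp$ from the set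 of black triangles to $\mathbb{H}\mathbb{P}^1$, with $L^\sharp_b=f^\sharp(b)$, is a Darboux transform of $f$ if $L^\sharp_b\ne L_v$ for every vertex $v$ of every black triangle $b$ and if for every white triangle the holonomy around it of the isomorphisms $L^\sharp_{b_1}\to\mathbb{H}^2/L_v\to L^\sharp_{b_2}$ (projection followed by inverse projection), for $b_1,b_2$ adjacent to the white triangle along its two edges incident to the vertex $v$, is trivial. Spectral curves. For a closed polygon of period $n$ put $H(\lambda)=(P_{n-1}+\lambda Q_{n-1})\cdots(P_0+\lambda Q_0)$, where $\lambda\in\mathbb{C}_*$ acts by right multiplication on the 4-dimensional complex vector space $(\mathbb{H}^2,\mathbf{i})$. The spectral curve of $\gamma$ is the normalization of $\{(\mu,\lambda)\in\mathbb{C}_*\times\mathbb{C}_*\mid\det(\mu-H(\lambda))=0\}$. The spectral curve of an immersed discrete torus $f$ is the normalization of $\mathrm{Spec}(V/L)\subset\mathrm{Hom}(\Gamma,\mathbb{C}_* )\cong\mathbb{C}_*\times\mathbb{C}_*$, the set of $h$ for which there is a non-trivial section $\psi$ of the pullback of $V/L$ (fibers $\mathbb{H}^2/L_v$) to the universal covering with $\gamma^*\psi=\psi h_\gamma$ for all $\gamma\in\Gamma$ that is holomorphic, i.e. for each black triangle $b$ there is $\hat\psi_b\in\mathbb{H}^2$ projecting to $\psi_v$ for all vertices $v$ of $b$. *)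

theory Defs
  imports "HOL-Analysis.Analysis" "HOL-Complex_Analysis.Complex_Analysis"
begin

section \<open>Quaternions\<close>

datatype quat = Quat (re_part: real) (i_part: real) (j_part: real) (k_part: real)

lemma quat_eq_iff:
  "x = y \<longleftrightarrow> re_part x = re_part y \<and> i_part x = i_part y \<and> j_part x = j_part y \<and> k_part x = k_part y"
  by (cases x; cases y) auto

instantiation quat :: division_ring
begin

definition "0 = Quat 0 0 0 0"
definition "1 = Quat 1 0 0 0"
definition "- x = Quat (- re_part x) (- i_part x) (- j_part x) (- k_part x)"
definition "x + y = Quat (re_part x + re_part y) (i_part x + i_part y)
                         (j_part x + j_part y) (k_part x + k_part y)"
definition "x - y = Quat (re_part x - re_part y) (i_part x - i_part y)
                         (j_part x - j_part y) (k_part x - k_part y)"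
definition "x * y = Quat
  (re_part x * re_part y - i_part x * i_part y - j_part x * j_part y - k_part x * k_part y)
  (re_part x * i_part y + i_part x * re_part y + j_part x * k_part y - k_part x * j_part y)
  (re_part x * j_part y - i_part x * k_part y + j_part x * re_part y + k_part x * i_part y)
  (re_part x * k_part y + i_part x * j_part y - j_part x * i_part y + k_part x * re_part y)"
definition "inverse x = (let N = (re_part x)\<^sup>2 + (i_part x)\<^sup>2 + (j_part x)\<^sup>2 + (k_part x)\<^sup>2
  in Quat (re_part x / N) (- i_part x / N) (- j_part x / N) (- k_part x / N))"
definition "x div y = x * inverse (y::quat)"

lemmas quat_ops = zero_quat_def one_quat_def uminus_quat_def plus_quat_def minus_quat_def times_quat_def

instance
proof
  fix a b c :: quat
  show "a * b * c = a * (b * c)" by (simp add: quat_ops algebra_simps)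
  show "1 * a = a" "a * 1 = a" by (simp_all add: quat_ops quat_eq_iff)
  show "(a + b) * c = a * c + b * c" "a * (b + c) = a * b + a * c"
    by (simp_all add: quat_ops algebra_simps)
  show "a + b + c = a + (b + c)" "a + b = b + a" "0 + a = a" "- a + a = 0" "a - b = a + - b"
    by (simp_all add: quat_ops quat_eq_iff)
  show "(0::quat) \<noteq> 1" by (simp add: quat_ops)
  show "a div b = a * inverse b" by (rule divide_quat_def)
  show "inverse (0::quat) = 0" by (simp add: inverse_quat_def quat_ops)
  define N where "N = (re_part a)\<^sup>2 + (i_part a)\<^sup>2 + (j_part a)\<^sup>2 + (k_part a)\<^sup>2"
  assume "a \<noteq> 0"
  then have "N \<noteq> 0"
    unfolding N_def quat_eq_iff quat_ops quat.sel
    by (smt (verit) not_sum_power2_lt_zero zero_le_power2 zero_eq_power2)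
  moreover have inv: "inverse a = Quat (re_part a / N) (- i_part a / N) (- j_part a / N) (- k_part a / N)"
    unfolding inverse_quat_def Let_def N_def by simp
  moreover have "N = re_part a * re_part a + i_part a * i_part a + j_part a * j_part a + k_part a * k_part a"
    by (simp add: N_def power2_eq_square)
  then have "(re_part a * re_part a + i_part a * i_part a + j_part a * j_part a + k_part a * k_part a) / N = 1"
    using \<open>N \<noteq> 0\<close> by simp
  ultimately show "inverse a * a = 1" "a * inverse a = 1"
    unfolding inv times_quat_def one_quat_def quat.sel quat.inject
    by (simp_all add: add_divide_distrib)
qed

end

text \<open>The embedding of \<open>\<complex> = Span\<^sub>\<real>{1, i}\<close>.\<close>
definition quat_of_complex :: "complex \<Rightarrow> quat" where
  "quat_of_complex z = Quat (Re z) (Im z) 0 0"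

section \<open>The quaternionic projective line\<close>

type_synonym hvec = "quat \<times> quat"

definition rscale :: "hvec \<Rightarrow> quat \<Rightarrow> hvec" (infixl "\<cdot>\<^sub>r" 75) where
  "x \<cdot>\<^sub>r a = (fst x * a, snd x * a)"

definition HP1 :: "hvec set set" where
  "HP1 = {range ((\<cdot>\<^sub>r) x) | x. x \<noteq> 0}"

text \<open>The projection to the summand \<open>A\<close> of a splitting \<open>\<H>\<^sup>2 = A \<oplus> B\<close>.\<close>
definition proj_along :: "hvec set \<Rightarrow> hvec set \<Rightarrow> hvec \<Rightarrow> hvec" where
  "proj_along A B x = (THE a. a \<in> A \<and> x - a \<in> B)"

text \<open>\<open>coset L x\<close> is the class of \<open>x\<close> in \<open>\<H>\<^sup>2/L\<close>; the quotient itself is \<open>range (coset L)\<close>,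
  with zero vector \<open>L = coset L 0\<close>.\<close>
definition coset :: "hvec set \<Rightarrow> hvec \<Rightarrow> hvec set" where
  "coset L x = (+) x ` L"

section \<open>Discrete curves and their Darboux transforms\<close>

definition idx :: "real set \<Rightarrow> int set" where
  "idx I = {n. real_of_int n \<in> I}"

definition discrete_curve :: "real set \<Rightarrow> (int \<Rightarrow> hvec set) \<Rightarrow> bool" where
  "discrete_curve I \<gamma> \<longleftrightarrow> (\<forall>n \<in> idx I. \<gamma> n \<in> HP1)"

definition polygon :: "real set \<Rightarrow> (int \<Rightarrow> hvec set) \<Rightarrow> bool" where
  "polygon I \<gamma> \<longleftrightarrow> discrete_curve I \<gamma> \<and>
     (\<forall>n \<in> idx I. (n + 1 \<in> idx I \<longrightarrow> \<gamma> n \<noteq> \<gamma> (n + 1)) \<and> (n + 2 \<in> idx I \<longrightarrow> \<gamma> n \<noteq> \<gamma> (n + 2)))"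

text \<open>The map \<open>P\<^sub>n + Q\<^sub>n \<lambda>\<close>, with \<open>\<lambda>\<close> acting by right multiplication.\<close>
definition darboux_step :: "(int \<Rightarrow> hvec set) \<Rightarrow> complex \<Rightarrow> int \<Rightarrow> hvec \<Rightarrow> hvec" where
  "darboux_step \<gamma> l n x =
     proj_along (\<gamma> n) (\<gamma> (n + 1)) x + proj_along (\<gamma> (n + 1)) (\<gamma> n) x \<cdot>\<^sub>r quat_of_complex l"

definition homogeneous_lift :: "real set \<Rightarrow> (int \<Rightarrow> hvec set) \<Rightarrow> (int \<Rightarrow> hvec) \<Rightarrow> bool" where
  "homogeneous_lift I \<eta> e \<longleftrightarrow> (\<forall>n \<in> idx I. e n \<in> \<eta> n \<and> e n \<noteq> 0)"

definition curve_darboux :: "real set \<Rightarrow> (int \<Rightarrow> hvec set) \<Rightarrow> (int \<Rightarrow> hvec set) \<Rightarrow> bool" where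
  "curve_darboux I \<gamma> \<eta> \<longleftrightarrow>
     (\<exists>l e. l \<noteq> 0 \<and> homogeneous_lift I \<eta> e \<and>
        (\<forall>n \<in> idx I. n + 1 \<in> idx I \<longrightarrow> e (n + 1) = darboux_step \<gamma> l n (e n))) \<and>
     (\<forall>n \<in> idx I. \<eta> n \<noteq> \<gamma> n \<and> (n + 1 \<in> idx I \<longrightarrow> \<eta> n \<noteq> \<gamma> (n + 1)))"

section \<open>Bi-colored triangulated surfaces and their Darboux transforms\<close>

text \<open>Triangles are labels and not sets of vertices: on the thin cylinder, a black and a white
  triangle can have the same vertices. If \<open>wvert w = (v\<^sub>0, v\<^sub>1, v\<^sub>2)\<close> and \<open>wadj w = (b\<^sub>0, b\<^sub>1, b\<^sub>2)\<close>,
  then \<open>b\<^sub>i\<close> is the black triangle across the edge of \<open>w\<close> opposite to \<open>v\<^sub>i\<close>; thus the edges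
  of \<open>w\<close> incident to \<open>v\<^sub>i\<close> are those shared with the two black triangles \<open>b\<^sub>j\<close>, \<open>j \<noteq> i\<close>.\<close>
record ('v, 'b, 'w) bicolored =
  Vert :: "'v set"
  Black :: "'b set"
  White :: "'w set"
  bvert :: "'b \<Rightarrow> 'v set"
  wvert :: "'w \<Rightarrow> 'v \<times> 'v \<times> 'v"
  wadj :: "'w \<Rightarrow> 'b \<times> 'b \<times> 'b"

text \<open>Every edge belongs to a black triangle.\<close>
definition immersion :: "('v, 'b, 'w) bicolored \<Rightarrow> ('v \<Rightarrow> hvec set) \<Rightarrow> bool" where
  "immersion M f \<longleftrightarrow> (\<forall>v \<in> Vert M. f v \<in> HP1) \<and>
     (\<forall>b \<in> Black M. \<forall>v \<in> bvert M b. \<forall>v' \<in> bvert M b. v \<noteq> v' \<longrightarrow> f v \<noteq> f v')"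

text \<open>The map \<open>L\<^sub>1 \<rightarrow> \<H>\<^sup>2/L \<rightarrow> L\<^sub>2\<close>, projection followed by inverse projection.\<close>
definition transport :: "hvec set \<Rightarrow> hvec set \<Rightarrow> hvec set \<Rightarrow> hvec \<Rightarrow> hvec" where
  "transport L1 L L2 x = inv_into L2 (coset L) (coset L x)"

definition trivial_holonomy ::
    "('v, 'b, 'w) bicolored \<Rightarrow> ('v \<Rightarrow> hvec set) \<Rightarrow> ('b \<Rightarrow> hvec set) \<Rightarrow> 'w \<Rightarrow> bool" where
  "trivial_holonomy M f f' w \<longleftrightarrow>
     (case (wvert M w, wadj M w) of ((v0, v1, v2), (b0, b1, b2)) \<Rightarrow>
       \<forall>x \<in> f' b0.
         transport (f' b2) (f v1) (f' b0)
          (transport (f' b1) (f v0) (f' b2)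
            (transport (f' b0) (f v2) (f' b1) x)) = x)"

definition surface_darboux ::
    "('v, 'b, 'w) bicolored \<Rightarrow> ('v \<Rightarrow> hvec set) \<Rightarrow> ('b \<Rightarrow> hvec set) \<Rightarrow> bool" where
  "surface_darboux M f f' \<longleftrightarrow> (\<forall>b \<in> Black M. f' b \<in> HP1) \<and>
     (\<forall>b \<in> Black M. \<forall>v \<in> bvert M b. f' b \<noteq> f v) \<and>
     (\<forall>w \<in> White M. trivial_holonomy M f f' w)"

section \<open>Thin cylinders\<close>

text \<open>For index sets with an end, a black triangle is kept if its number is an index (it carries
  a value of \<open>f\<^sup>\<sharp>\<close>), but only with those of its vertices which are present; a white triangle is
  kept if all its vertices, equivalently all three black neighbours, are present.\<close>
definition thin_cylinder :: "real set \<Rightarrow> (int, int, int) bicolored" where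
  "thin_cylinder I = \<lparr>Vert = idx I, Black = idx I,
     White = {n. {n - 1, n, n + 1} \<subseteq> idx I},
     bvert = (\<lambda>n. {n, n + 1, n - 1} \<inter> idx I),
     wvert = (\<lambda>n. (n, n + 1, n - 1)),
     wadj = (\<lambda>n. (n, n - 1, n + 1))\<rparr>"

text \<open>The universal covering; the covering map is \<open>fst\<close> on vertices and on triangles.\<close>
definition thin_cover :: "real set \<Rightarrow> (int \<times> int, int \<times> int, int \<times> int) bicolored" where
  "thin_cover I = \<lparr>Vert = idx I \<times> UNIV, Black = idx I \<times> UNIV,
     White = {n. {n - 1, n, n + 1} \<subseteq> idx I} \<times> UNIV,
     bvert = (\<lambda>(n, k). {(n, k), (n + 1, k), (n - 1, k + 1)} \<inter> idx I \<times> UNIV),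
     wvert = (\<lambda>(n, k). ((n, k + 1), (n + 1, k), (n - 1, k + 1))),
     wadj = (\<lambda>(n, k). ((n, k), (n - 1, k + 1), (n + 1, k)))\<rparr>"

lemma thin_cover_projection:
  "fst ` bvert (thin_cover I) b = bvert (thin_cylinder I) (fst b)"
  "map_prod fst (map_prod fst fst) (wvert (thin_cover I) w) = wvert (thin_cylinder I) (fst w)"
  "map_prod fst (map_prod fst fst) (wadj (thin_cover I) w) = wadj (thin_cylinder I) (fst w)"
  by (cases b; force simp: thin_cover_def thin_cylinder_def)
     (cases w; simp add: thin_cover_def thin_cylinder_def)+

lemma thin_cover_adjacency:
  assumes "w \<in> White (thin_cover I)"
    and "wvert (thin_cover I) w = (v0, v1, v2)" and "wadj (thin_cover I) w = (b0, b1, b2)"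
  shows "bvert (thin_cover I) b0 \<inter> {v0, v1, v2} = {v1, v2}"
    "bvert (thin_cover I) b1 \<inter> {v0, v1, v2} = {v0, v2}"
    "bvert (thin_cover I) b2 \<inter> {v0, v1, v2} = {v0, v1}"
  using assms by (auto simp: thin_cover_def)

lemma immersion_thin_cylinder_iff:
  assumes "is_interval I"
  shows "immersion (thin_cylinder I) \<gamma> \<longleftrightarrow> polygon I \<gamma>"
proof
  assume imm: "immersion (thin_cylinder I) \<gamma>"
  have ne: "\<gamma> v \<noteq> \<gamma> v'"
    if "b \<in> idx I" "v \<in> {b, b + 1, b - 1} \<inter> idx I" "v' \<in> {b, b + 1, b - 1} \<inter> idx I" "v \<noteq> v'"
    for b v v'
    using imm that unfolding immersion_def thin_cylinder_def by force
  have mid: "n + 1 \<in> idx I" if "n \<in> idx I" "n + 2 \<in> idx I" for n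
    using mem_is_interval_1_I[OF assms, of "real_of_int n" "real_of_int (n + 2)" "real_of_int (n + 1)"] that
    by (simp add: idx_def)
  show "polygon I \<gamma>"
    unfolding polygon_def discrete_curve_def
  proof (intro conjI ballI impI)
    fix n assume n: "n \<in> idx I"
    show "\<gamma> n \<in> HP1" using imm n by (auto simp: immersion_def thin_cylinder_def)
    show "\<gamma> n \<noteq> \<gamma> (n + 1)" if "n + 1 \<in> idx I" using ne[of n n "n + 1"] n that by auto
    show "\<gamma> n \<noteq> \<gamma> (n + 2)" if "n + 2 \<in> idx I"
      using ne[of "n + 1" n "n + 2"] mid[OF n that] n that by auto
  qed
next
  assume pol: "polygon I \<gamma>"
  have 1: "\<gamma> n \<noteq> \<gamma> (n + 1)" "\<gamma> (n + 1) \<noteq> \<gamma> n" if "n \<in> idx I" "n + 1 \<in> idx I" for n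
    using pol that by (auto simp: polygon_def)
  have 2: "\<gamma> n \<noteq> \<gamma> (n + 2)" "\<gamma> (n + 2) \<noteq> \<gamma> n" if "n \<in> idx I" "n + 2 \<in> idx I" for n
    using pol that by (auto simp: polygon_def)
  have "\<gamma> v \<noteq> \<gamma> v'"
    if "v \<in> {b, b + 1, b - 1}" "v' \<in> {b, b + 1, b - 1}" "v \<in> idx I" "v' \<in> idx I" "v \<noteq> v'" for b v v'
  proof -
    have "v' = v + 1 \<or> v = v' + 1 \<or> v' = v + 2 \<or> v = v' + 2"
      using that by auto
    then show ?thesis
      using 1 2 that(3,4) by metis
  qed
  then show "immersion (thin_cylinder I) \<gamma>"
    using pol unfolding immersion_def thin_cylinder_def polygon_def discrete_curve_def
    by (simp del: insert_iff) blast
qed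

section \<open>Normalization of a plane analytic curve\<close>

text \<open>The normalization is the Riemann surface of the local irreducible branches of the curve.
  A branch is represented by its injective holomorphic parametrizations, taken modulo
  biholomorphic changes of the parameter near \<open>0\<close>; it lies over the value at \<open>0\<close>.\<close>
definition local_param :: "(complex \<times> complex) set \<Rightarrow> complex set \<Rightarrow> (complex \<Rightarrow> complex \<times> complex) \<Rightarrow> bool" where
  "local_param C U \<phi> \<longleftrightarrow> open U \<and> (fst \<circ> \<phi>) holomorphic_on U \<and> (snd \<circ> \<phi>) holomorphic_on U \<and>
     inj_on \<phi> U \<and> \<phi> ` U \<subseteq> C"

type_synonym branch = "(complex \<Rightarrow> complex \<times> complex) set"

definition branch_of :: "(complex \<Rightarrow> complex \<times> complex) \<Rightarrow> branch" where
  "branch_of \<phi> = {\<psi>. \<exists>\<theta>. \<theta> analytic_on {0} \<and> \<theta> 0 = 0 \<and> deriv \<theta> 0 \<noteq> 0 \<and>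
     (\<forall>\<^sub>F t in nhds 0. \<psi> t = \<phi> (\<theta> t))}"

text \<open>\<open>Charts\<close> consists of the inverses of the holomorphic charts (with their domains); it determines
  topology and complex structure. \<open>Proj\<close> is the normalization map to the curve.\<close>
record riemann_surface_over =
  Points :: "branch set"
  Proj :: "branch \<Rightarrow> complex \<times> complex"
  Charts :: "(complex set \<times> (complex \<Rightarrow> branch)) set"

definition normalization :: "(complex \<times> complex) set \<Rightarrow> riemann_surface_over" where
  "normalization C = \<lparr>
     Points = {branch_of \<phi> | \<phi> U. local_param C U \<phi> \<and> 0 \<in> U},
     Proj = restrict (\<lambda>\<beta>. THE p. \<forall>\<psi> \<in> \<beta>. \<psi> 0 = p) {branch_of \<phi> | \<phi> U. local_param C U \<phi> \<and> 0 \<in> U},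
     Charts = {(U, restrict (\<lambda>s. branch_of (\<lambda>t. \<phi> (s + t))) U) | U \<phi>. local_param C U \<phi>}\<rparr>"

section \<open>The spectral curve of a closed polygon\<close>

text \<open>Complex coordinates of \<open>(\<H>\<^sup>2, i)\<close> with respect to the basis \<open>(1,0), (j,0), (0,1), (0,j)\<close>:
  \<open>a + b i + c j + d k = (a + b i) + j (c - d i)\<close>.\<close>
definition to_C4 :: "hvec \<Rightarrow> complex ^ 4" where
  "to_C4 x = (\<chi> m. if m = 1 then Complex (re_part (fst x)) (i_part (fst x))
              else if m = 2 then Complex (j_part (fst x)) (- k_part (fst x))
              else if m = 3 then Complex (re_part (snd x)) (i_part (snd x))
              else Complex (j_part (snd x)) (- k_part (snd x)))"

definition of_C4 :: "complex ^ 4 \<Rightarrow> hvec" where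
  "of_C4 z = (Quat (Re (z $ 1)) (Im (z $ 1)) (Re (z $ 2)) (- Im (z $ 2)),
              Quat (Re (z $ 3)) (Im (z $ 3)) (Re (z $ 4)) (- Im (z $ 4)))"

lemma of_C4_to_C4: "of_C4 (to_C4 x) = x"
  by (simp add: of_C4_def to_C4_def quat_eq_iff prod_eq_iff)

lemma to_C4_of_C4: "to_C4 (of_C4 z) = z"
  unfolding vec_eq_iff using exhaust_4 by (auto simp: of_C4_def to_C4_def)

lemma to_C4_add: "to_C4 (x + y) = to_C4 x + to_C4 y"
  by (simp add: to_C4_def vec_eq_iff quat_ops complex_eq_iff)

lemma to_C4_rscale: "to_C4 (x \<cdot>\<^sub>r quat_of_complex c) = c *s to_C4 x"
  by (simp add: to_C4_def vec_eq_iff quat_ops rscale_def quat_of_complex_def complex_eq_iff algebra_simps)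

definition cdet :: "(hvec \<Rightarrow> hvec) \<Rightarrow> complex" where
  "cdet T = det (matrix (to_C4 \<circ> T \<circ> of_C4))"

primrec curve_holonomy :: "(int \<Rightarrow> hvec set) \<Rightarrow> complex \<Rightarrow> nat \<Rightarrow> hvec \<Rightarrow> hvec" where
  "curve_holonomy \<gamma> l 0 = id"
| "curve_holonomy \<gamma> l (Suc m) = darboux_step \<gamma> l (int m) \<circ> curve_holonomy \<gamma> l m"

definition closed_polygon :: "nat \<Rightarrow> (int \<Rightarrow> hvec set) \<Rightarrow> bool" where
  "closed_polygon N \<gamma> \<longleftrightarrow> 0 < N \<and> polygon UNIV \<gamma> \<and> (\<forall>n. \<gamma> (n + int N) = \<gamma> n)"

definition polygon_spectral_curve :: "nat \<Rightarrow> (int \<Rightarrow> hvec set) \<Rightarrow> riemann_surface_over" where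
  "polygon_spectral_curve N \<gamma> = normalization {(m, l). m \<noteq> 0 \<and> l \<noteq> 0 \<and>
     cdet (\<lambda>x. x \<cdot>\<^sub>r quat_of_complex m - curve_holonomy \<gamma> l N x) = 0}"

section \<open>The spectral curve of a discrete torus\<close>

text \<open>\<open>U\<close> is the universal covering, \<open>G\<close> the group of deck transformations and \<open>F\<close> the pullback
  of the immersion to \<open>U\<close>.\<close>

definition quotient_section :: "('v, 'b, 'w) bicolored \<Rightarrow> ('v \<Rightarrow> hvec set) \<Rightarrow> ('v \<Rightarrow> hvec set) \<Rightarrow> bool" where
  "quotient_section U F \<psi> \<longleftrightarrow> (\<forall>v \<in> Vert U. \<psi> v \<in> range (coset (F v)))"

definition holomorphic_section :: "('v, 'b, 'w) bicolored \<Rightarrow> ('v \<Rightarrow> hvec set) \<Rightarrow> ('v \<Rightarrow> hvec set) \<Rightarrow> bool" where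
  "holomorphic_section U F \<psi> \<longleftrightarrow> (\<forall>b \<in> Black U. \<exists>x. \<forall>v \<in> bvert U b. \<psi> v = coset (F v) x)"

definition nontrivial_section :: "('v, 'b, 'w) bicolored \<Rightarrow> ('v \<Rightarrow> hvec set) \<Rightarrow> ('v \<Rightarrow> hvec set) \<Rightarrow> bool" where
  "nontrivial_section U F \<psi> \<longleftrightarrow> (\<exists>v \<in> Vert U. \<psi> v \<noteq> coset (F v) 0)"

definition has_monodromy :: "('v, 'b, 'w) bicolored \<Rightarrow> ('v \<Rightarrow> 'v) set \<Rightarrow> (('v \<Rightarrow> 'v) \<Rightarrow> complex) \<Rightarrow> ('v \<Rightarrow> hvec set) \<Rightarrow> bool" where
  "has_monodromy U G h \<psi> \<longleftrightarrow>
     (\<forall>g \<in> G. \<forall>v \<in> Vert U. \<psi> (g v) = (\<lambda>x. x \<cdot>\<^sub>r quat_of_complex (h g)) ` \<psi> v)"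

definition multiplicative_character :: "('v \<Rightarrow> 'v) set \<Rightarrow> (('v \<Rightarrow> 'v) \<Rightarrow> complex) \<Rightarrow> bool" where
  "multiplicative_character G h \<longleftrightarrow>
     (\<forall>g \<in> G. h g \<noteq> 0) \<and> (\<forall>g \<in> G. \<forall>g' \<in> G. h (g \<circ> g') = h g * h g')"

definition spectrum :: "('v, 'b, 'w) bicolored \<Rightarrow> ('v \<Rightarrow> 'v) set \<Rightarrow> ('v \<Rightarrow> hvec set) \<Rightarrow> (('v \<Rightarrow> 'v) \<Rightarrow> complex) set" where
  "spectrum U G F = {h. multiplicative_character G h \<and>
     (\<exists>\<psi>. quotient_section U F \<psi> \<and> holomorphic_section U F \<psi> \<and> nontrivial_section U F \<psi> \<and>
          has_monodromy U G h \<psi>)}"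

text \<open>\<open>s\<close> and \<open>t\<close> are generators of \<open>G \<cong> \<int>\<^sup>2\<close>; they identify \<open>Hom(G, \<complex>\<^sub>*)\<close> with \<open>\<complex>\<^sub>* \<times> \<complex>\<^sub>*\<close>.\<close>
definition torus_spectral_curve ::
    "('v, 'b, 'w) bicolored \<Rightarrow> ('v \<Rightarrow> 'v) set \<Rightarrow> ('v \<Rightarrow> 'v) \<Rightarrow> ('v \<Rightarrow> 'v) \<Rightarrow> ('v \<Rightarrow> hvec set) \<Rightarrow> riemann_surface_over" where
  "torus_spectral_curve U G s t F = normalization ((\<lambda>h. (h s, h t)) ` spectrum U G F)"

text \<open>The thin torus is \<open>thin_cover UNIV\<close> modulo \<open>range (deck N)\<close>; its vertices are numbered by
  \<open>{0..<N}\<close>, and \<open>\<gamma>\<close> defines the immersion with value \<open>\<gamma> n\<close> at the vertex with number \<open>n\<close>.\<close>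
definition deck :: "nat \<Rightarrow> int \<times> int \<Rightarrow> int \<times> int \<Rightarrow> int \<times> int" where
  "deck N = (\<lambda>(a, b) (n, k). (n + a * int N, k + b))"

definition thin_torus_vertex :: "nat \<Rightarrow> int \<times> int \<Rightarrow> int" where
  "thin_torus_vertex N = (\<lambda>(n, k). n mod int N)"

definition thin_torus_spectral_curve :: "nat \<Rightarrow> (int \<Rightarrow> hvec set) \<Rightarrow> riemann_surface_over" where
  "thin_torus_spectral_curve N \<gamma> =
     torus_spectral_curve (thin_cover UNIV) (range (deck N)) (deck N (1, 0)) (deck N (0, 1))
       (\<gamma> \<circ> thin_torus_vertex N)"

end

theory Submission
  imports Defs
begin

text \<open>
  A lift \<open>e\<close> of a Darboux transform \<open>\<eta>\<close> satisfies \<open>e (n + 1) = P\<^sub>n (e n) + Q\<^sub>n (e n) \<lambda>\<close>. Since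
  \<open>P\<^sub>n\<close> and \<open>Q\<^sub>n\<close> are the projections of the splitting \<open>\<H>\<^sup>2 = \<gamma> n \<oplus> \<gamma> (n + 1)\<close>, this single equation
  is the same as the two congruences
    \<open>e (n + 1) \<equiv> e n\<close> modulo \<open>\<gamma> (n + 1)\<close>  and  \<open>e (n + 1) \<equiv> e n \<cdot> \<lambda>\<close> modulo \<open>\<gamma> n\<close>
  (lemma \<open>darboux_step_iff\<close>), and congruences modulo the lines \<open>\<gamma> v\<close> are also what the surface theory
  is about: the isomorphisms around white triangles, as well as the condition for a section of the
  quotient bundle to be holomorphic.

  For Darboux transforms, choose a lift \<open>e\<close> with \<open>e (n + 1) \<equiv> e n\<close> modulo \<open>\<gamma> (n + 1)\<close>, which is
  possible and unique up to one right factor as long as \<open>\<eta>\<close> is non-degenerate. Then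
  \<open>e (n + 1) \<equiv> e n \<cdot> q n\<close> modulo \<open>\<gamma> n\<close> for some quaternions \<open>q n \<noteq> 0\<close>, and the holonomy around the white triangle with number \<open>n\<close> maps \<open>e n\<close>
  to \<open>e n \<cdot> (q n)\<inverse> q (n - 1)\<close> (lemma \<open>thin_cylinder_holonomy_iff\<close>). Hence all holonomies are trivial
  if and only if \<open>q\<close> is constant. A constant \<open>q\<close> is conjugate to some \<open>\<lambda> \<in> \<complex>\<close>, and the
  remaining freedom of a right factor of \<open>e\<close> can be used to achieve \<open>q = \<lambda>\<close>.

  For spectral curves, both normalizations are taken of the same subset of \<open>\<complex>\<^sub>* \<times> \<complex>\<^sub>*\<close>. A
  holomorphic section \<open>\<psi>\<close> with monodromy \<open>(\<mu>, \<lambda>)\<close> has a unique lift \<open>x n \<in> \<H>\<^sup>2\<close> on the black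
  triangle \<open>(n, 0)\<close>, because \<open>\<gamma> n \<inter> \<gamma> (n + 1) = 0\<close>. As the third vertex of the triangle \<open>(n + 1, 0)\<close>
  is \<open>(n, 1)\<close>, where \<open>\<psi>\<close> is \<open>\<lambda>\<close> times its value at \<open>(n, 0)\<close>, the lifts satisfy
  the two congruences above, i.e. \<open>x\<close> solves the recursion of the Darboux transformation,
  and horizontal monodromy \<open>\<mu>\<close> says that \<open>x 0\<close> is an eigenvector of \<open>H(\<lambda>)\<close> with eigenvalue \<open>\<mu>\<close>. All
  steps can be reversed, since \<open>P\<^sub>n + Q\<^sub>n \<lambda>\<close> is invertible for \<open>\<lambda> \<noteq> 0\<close>.
\<close>

section \<open>Quaternions and complex numbers\<close>

lemma quat_of_complex_mult: "quat_of_complex (a * b) = quat_of_complex a * quat_of_complex b"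
  by (simp add: quat_of_complex_def quat_ops)

lemma quat_of_complex_0 [simp]: "quat_of_complex 0 = 0"
  and quat_of_complex_1 [simp]: "quat_of_complex 1 = 1"
  by (simp_all add: quat_of_complex_def quat_ops)

lemma quat_of_complex_eq_0_iff [simp]: "quat_of_complex a = 0 \<longleftrightarrow> a = 0"
  by (simp add: quat_of_complex_def quat_ops complex_eq_iff)

text \<open>If \<open>q = a + v\<close> with \<open>v\<close> imaginary of length \<open>r\<close>, then \<open>v\<^sup>2 = - r\<^sup>2 = (r i)\<^sup>2\<close>, so that
  \<open>u = v + r i\<close> satisfies \<open>v u = - r\<^sup>2 + r v i = u (r i)\<close>.\<close>
lemma quat_conjugate_to_complex:
  obtains u l where "u \<noteq> 0" "q * u = u * quat_of_complex l"
proof (cases "j_part q = 0 \<and> k_part q = 0")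
  case True
  \<comment> \<open>This case is separate because \<open>u = v + r i\<close> vanishes for \<open>v = - r i\<close>.\<close>
  then have "q * 1 = 1 * quat_of_complex (Complex (re_part q) (i_part q))"
    by (simp add: quat_of_complex_def quat_eq_iff)
  then show ?thesis
    using that by (metis zero_neq_one)
next
  case False
  define r where "r = sqrt ((i_part q)\<^sup>2 + (j_part q)\<^sup>2 + (k_part q)\<^sup>2)"
  have r: "r * r = i_part q * i_part q + j_part q * j_part q + k_part q * k_part q"
    unfolding r_def by (simp add: power2_eq_square)
  define u where "u = Quat 0 (i_part q + r) (j_part q) (k_part q)"
  have "u \<noteq> 0"
    using False by (simp add: u_def quat_ops)
  moreover have "q * u = u * quat_of_complex (Complex (re_part q) r)"
    using r by (simp add: u_def quat_of_complex_def quat_ops algebra_simps)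
  ultimately show ?thesis
    by (rule that)
qed

section \<open>Lines in the quaternionic plane and congruences modulo lines\<close>

lemma rscale_assoc: "x \<cdot>\<^sub>r a \<cdot>\<^sub>r b = x \<cdot>\<^sub>r (a * b)"
  and rscale_add: "(x + y) \<cdot>\<^sub>r a = x \<cdot>\<^sub>r a + y \<cdot>\<^sub>r a"
  and rscale_diff: "(x - y) \<cdot>\<^sub>r a = x \<cdot>\<^sub>r a - y \<cdot>\<^sub>r a"
  and rscale_add_right: "x \<cdot>\<^sub>r (a + b) = x \<cdot>\<^sub>r a + x \<cdot>\<^sub>r b"
  and rscale_diff_right: "x \<cdot>\<^sub>r (a - b) = x \<cdot>\<^sub>r a - x \<cdot>\<^sub>r b"
  by (simp_all add: rscale_def prod_eq_iff algebra_simps)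

lemma rscale_simps [simp]: "0 \<cdot>\<^sub>r a = 0" "x \<cdot>\<^sub>r 0 = 0" "x \<cdot>\<^sub>r 1 = x"
  by (simp_all add: rscale_def prod_eq_iff)

lemma rscale_eq_0_iff [simp]: "x \<cdot>\<^sub>r a = 0 \<longleftrightarrow> x = 0 \<or> a = 0"
  by (auto simp: rscale_def prod_eq_iff)

lemma rscale_cancel:
  assumes "a \<noteq> 0"
  shows "x \<cdot>\<^sub>r a = y \<cdot>\<^sub>r a \<longleftrightarrow> x = y"
  using assms rscale_eq_0_iff[of "x - y" a] by (simp add: rscale_diff)

lemma rscale_complex_commute:
  "x \<cdot>\<^sub>r quat_of_complex a \<cdot>\<^sub>r quat_of_complex b = x \<cdot>\<^sub>r quat_of_complex b \<cdot>\<^sub>r quat_of_complex a"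
  by (simp add: rscale_assoc quat_of_complex_mult[symmetric] mult.commute)

lemma HP1_cases:
  assumes "L \<in> HP1"
  obtains x where "x \<noteq> 0" "x \<in> L" "L = range ((\<cdot>\<^sub>r) x)"
  using assms unfolding HP1_def by (force intro: image_eqI[of _ _ 1])

lemma HP1_zero: "L \<in> HP1 \<Longrightarrow> 0 \<in> L"
  by (erule HP1_cases) (force intro: image_eqI[of _ _ 0])

lemma HP1_rscale: "L \<in> HP1 \<Longrightarrow> x \<in> L \<Longrightarrow> x \<cdot>\<^sub>r a \<in> L"
  by (erule HP1_cases) (auto simp: rscale_assoc)

lemma HP1_rscale_iff:
  assumes "L \<in> HP1" "a \<noteq> 0"
  shows "x \<cdot>\<^sub>r a \<in> L \<longleftrightarrow> x \<in> L"
  using HP1_rscale[OF assms(1), of "x \<cdot>\<^sub>r a" "inverse a"] HP1_rscale[OF assms(1), of x a] assms(2)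
  by (auto simp: rscale_assoc)

lemma HP1_add: "L \<in> HP1 \<Longrightarrow> x \<in> L \<Longrightarrow> y \<in> L \<Longrightarrow> x + y \<in> L"
  by (erule HP1_cases) (auto simp: rscale_add_right[symmetric])

lemma HP1_diff: "L \<in> HP1 \<Longrightarrow> x \<in> L \<Longrightarrow> y \<in> L \<Longrightarrow> x - y \<in> L"
  by (erule HP1_cases) (auto simp: rscale_diff_right[symmetric])

lemma HP1_multiple:
  assumes "L \<in> HP1" "x \<in> L" "y \<in> L" "x \<noteq> 0"
  obtains a where "y = x \<cdot>\<^sub>r a"
proof -
  obtain z where L: "L = range ((\<cdot>\<^sub>r) z)"
    using assms(1) by (rule HP1_cases)
  obtain a b where "x = z \<cdot>\<^sub>r a" "y = z \<cdot>\<^sub>r b"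
    using assms(2,3) unfolding L by auto
  then have "y = x \<cdot>\<^sub>r (inverse a * b)"
    using assms(4) by (simp add: rscale_assoc mult.assoc[symmetric])
  then show ?thesis
    by (rule that)
qed

lemma HP1_Int:
  assumes "L \<in> HP1" "M \<in> HP1" "L \<noteq> M" "x \<in> L" "x \<in> M"
  shows "x = 0"
proof (rule ccontr)
  assume x: "x \<noteq> 0"
  have "y \<in> M" if "y \<in> L" for y
    using HP1_multiple[OF assms(1,4) that x] HP1_rscale[OF assms(2,5)] by metis
  moreover have "y \<in> L" if "y \<in> M" for y
    using HP1_multiple[OF assms(2,5) that x] HP1_rscale[OF assms(1,4)] by metis
  ultimately show False
    using assms(3) by blast
qed

text \<open>Gaussian elimination, with a generator \<open>x\<close> of \<open>L\<close> as the pivot: subtracting multiples of \<open>x\<close> leaves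
  vectors with only one non-zero coordinate, and these are multiples of the remainder of a generator
  \<open>y\<close> of \<open>M\<close>.\<close>
lemma HP1_splitting:
  assumes "L \<in> HP1" "M \<in> HP1" "L \<noteq> M"
  obtains a where "a \<in> L" "z - a \<in> M"
proof -
  obtain x where x: "x \<noteq> 0" "x \<in> L"
    using assms(1) by (rule HP1_cases)
  obtain y where y: "y \<noteq> 0" "y \<in> M"
    using assms(2) by (rule HP1_cases)
  have y': "y - x \<cdot>\<^sub>r c \<noteq> 0" for c
  proof
    assume "y - x \<cdot>\<^sub>r c = 0"
    then have "y \<in> L"
      using HP1_rscale[OF assms(1) x(2), of c] by simp
    then show False
      using HP1_Int[OF assms(1-3) _ y(2)] y(1) by blast
  qed
  \<comment> \<open>Then \<open>y \<cdot> d\<close> is the component of \<open>z\<close> in \<open>M\<close>, and \<open>x \<cdot> (b - c * d)\<close> the one in \<open>L\<close>.\<close>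
  have "\<exists>b c d. z - x \<cdot>\<^sub>r b = (y - x \<cdot>\<^sub>r c) \<cdot>\<^sub>r d"
  proof (cases "fst x = 0")
    case False
    let ?c = "inverse (fst x) * fst y" and ?b = "inverse (fst x) * fst z"
    have "z - x \<cdot>\<^sub>r ?b = (y - x \<cdot>\<^sub>r ?c) \<cdot>\<^sub>r (inverse (snd (y - x \<cdot>\<^sub>r ?c)) * snd (z - x \<cdot>\<^sub>r ?b))"
      using y'[of ?c] False by (simp add: rscale_def prod_eq_iff mult.assoc[symmetric])
    then show ?thesis
      by blast
  next
    case True
    let ?c = "inverse (snd x) * snd y" and ?b = "inverse (snd x) * snd z"
    have "snd x \<noteq> 0"
      using True x(1) by (simp add: prod_eq_iff)
    then have "z - x \<cdot>\<^sub>r ?b = (y - x \<cdot>\<^sub>r ?c) \<cdot>\<^sub>r (inverse (fst (y - x \<cdot>\<^sub>r ?c)) * fst (z - x \<cdot>\<^sub>r ?b))"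
      using y'[of ?c] by (simp add: rscale_def prod_eq_iff mult.assoc[symmetric])
    then show ?thesis
      by blast
  qed
  then obtain b c d where bcd: "z - x \<cdot>\<^sub>r b = (y - x \<cdot>\<^sub>r c) \<cdot>\<^sub>r d"
    by blast
  have "z - x \<cdot>\<^sub>r (b - c * d) = y \<cdot>\<^sub>r d"
    using bcd by (simp add: rscale_diff rscale_diff_right rscale_assoc algebra_simps)
  then show ?thesis
    using that HP1_rscale[OF assms(1) x(2)] HP1_rscale[OF assms(2) y(2)] by metis
qed

text \<open>In the sequel, \<open>coset L x = coset L y\<close> is the notation for \<open>x \<equiv> y\<close> modulo \<open>L\<close>; congruence is then
  an equivalence relation for free.\<close>
lemma coset_eq_iff:
  assumes "L \<in> HP1"
  shows "coset L x = coset L y \<longleftrightarrow> x - y \<in> L"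
proof
  assume "coset L x = coset L y"
  moreover have "x \<in> coset L x"
    using HP1_zero[OF assms] by (force simp: coset_def)
  ultimately show "x - y \<in> L"
    by (auto simp: coset_def)
next
  have sub: "coset L x \<subseteq> coset L y" if "x - y \<in> L" for x y
  proof
    fix v assume "v \<in> coset L x"
    then obtain a where a: "a \<in> L" "v = x + a"
      by (auto simp: coset_def)
    have "v = y + ((x - y) + a)"
      by (simp add: a)
    then show "v \<in> coset L y"
      unfolding coset_def using HP1_add[OF assms that a(1)] by blast
  qed
  assume "x - y \<in> L"
  moreover from this have "y - x \<in> L"
    using HP1_diff[OF assms HP1_zero[OF assms]] by (metis diff_0 minus_diff_eq)
  ultimately show "coset L x = coset L y"
    using sub by blast
qed

lemma coset_eq_0_iff: "L \<in> HP1 \<Longrightarrow> coset L x = coset L 0 \<longleftrightarrow> x \<in> L"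
  by (simp add: coset_eq_iff)

lemma coset_rscale_iff:
  assumes "L \<in> HP1" "a \<noteq> 0"
  shows "coset L (x \<cdot>\<^sub>r a) = coset L (y \<cdot>\<^sub>r a) \<longleftrightarrow> coset L x = coset L y"
  using assms by (simp add: coset_eq_iff rscale_diff[symmetric] HP1_rscale_iff)

lemma coset_rscale:
  assumes "L \<in> HP1" "coset L x = coset L y"
  shows "coset L (x \<cdot>\<^sub>r a) = coset L (y \<cdot>\<^sub>r a)"
  using assms by (cases "a = 0") (simp_all add: coset_rscale_iff)

lemma coset_add:
  assumes "L \<in> HP1" "coset L x = coset L x'" "coset L y = coset L y'"
  shows "coset L (x + y) = coset L (x' + y')"
  using assms HP1_add[OF assms(1), of "x - x'" "y - y'"] by (simp add: coset_eq_iff algebra_simps)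

lemma rscale_image_coset:
  assumes "L \<in> HP1" "a \<noteq> 0"
  shows "(\<lambda>x. x \<cdot>\<^sub>r a) ` coset L x = coset L (x \<cdot>\<^sub>r a)"
proof -
  have "(\<lambda>x. x \<cdot>\<^sub>r a) ` L = L"
  proof
    show "L \<subseteq> (\<lambda>x. x \<cdot>\<^sub>r a) ` L"
    proof
      fix y assume "y \<in> L"
      moreover have "y = (y \<cdot>\<^sub>r inverse a) \<cdot>\<^sub>r a"
        using assms(2) by (simp add: rscale_assoc)
      ultimately show "y \<in> (\<lambda>x. x \<cdot>\<^sub>r a) ` L"
        using HP1_rscale[OF assms(1)] by blast
    qed
  qed (use HP1_rscale[OF assms(1)] in blast)
  then have "coset L (x \<cdot>\<^sub>r a) = (+) (x \<cdot>\<^sub>r a) ` (\<lambda>x. x \<cdot>\<^sub>r a) ` L"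
    by (simp add: coset_def)
  then show ?thesis
    by (simp add: coset_def image_image rscale_add)
qed

lemma coset_eqD:
  assumes "L \<in> HP1" "M \<in> HP1" "L \<noteq> M" "coset L x = coset L y" "coset M x = coset M y"
  shows "x = y"
  using HP1_Int[OF assms(1-3), of "x - y"] assms by (simp add: coset_eq_iff)

lemma coset_simultaneous:
  assumes "L \<in> HP1" "M \<in> HP1" "L \<noteq> M"
  obtains z where "coset L z = coset L x" "coset M z = coset M y"
proof -
  obtain a where a: "a \<in> L" "(y - x) - a \<in> M"
    using HP1_splitting[OF assms] .
  have "coset L (x + a) = coset L x"
    using a(1) assms(1) by (simp add: coset_eq_iff)
  moreover have "coset M y = coset M (x + a)"
    using a(2) assms(2) by (simp add: coset_eq_iff algebra_simps)
  ultimately show ?thesis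
    using that by metis
qed

lemma HP1_nonzero_coset:
  assumes "L \<in> HP1" "M \<in> HP1" "M \<noteq> L" "x \<in> M" "x \<noteq> 0"
  shows "coset L x \<noteq> coset L 0"
  using HP1_Int[OF assms(1,2) assms(3)[symmetric], of x] assms by (auto simp: coset_eq_0_iff)

text \<open>As \<open>\<H>\<^sup>2 = L \<oplus> M\<close>, the projection \<open>M \<rightarrow> \<H>\<^sup>2/L\<close> is an isomorphism; this is its surjectivity.\<close>
lemma coset_representative:
  assumes "L \<in> HP1" "M \<in> HP1" "M \<noteq> L"
  obtains y where "y \<in> M" "coset L y = coset L x"
proof -
  obtain z where "coset L z = coset L x" "coset M z = coset M 0"
    using coset_simultaneous[OF assms(1,2) assms(3)[symmetric]] .
  then show ?thesis
    using that assms(2) by (simp add: coset_eq_0_iff)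
qed

lemma nonzero_coset_representative:
  assumes "L \<in> HP1" "M \<in> HP1" "M' \<in> HP1" "M \<noteq> L" "M' \<noteq> L" "x \<in> M" "x \<noteq> 0"
  obtains y where "y \<in> M'" "y \<noteq> 0" "coset L y = coset L x"
proof -
  obtain y where y: "y \<in> M'" "coset L y = coset L x"
    using coset_representative[OF assms(1,3,5)] .
  moreover have "y \<noteq> 0"
    using y(2) HP1_nonzero_coset[OF assms(1,2,4,6,7)] by auto
  ultimately show ?thesis
    using that by blast
qed

lemma transport_eqI:
  assumes "L \<in> HP1" "M \<in> HP1" "M \<noteq> L" "y \<in> M" "coset L y = coset L x"
  shows "transport K L M x = y"
proof -
  have "inj_on (coset L) M"
  proof
    fix a b assume ab: "a \<in> M" "b \<in> M" "coset L a = coset L b"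
    have "coset M a = coset M b"
      using HP1_diff[OF assms(2) ab(1,2)] assms(2) by (simp add: coset_eq_iff)
    then show "a = b"
      using coset_eqD[OF assms(1,2) assms(3)[symmetric] ab(3)] by blast
  qed
  then show ?thesis
    unfolding transport_def assms(5)[symmetric] using assms(4) by (rule inv_into_f_f)
qed

section \<open>The recursion of the Darboux transformation\<close>

lemma proj_along_eqI:
  assumes "L \<in> HP1" "M \<in> HP1" "L \<noteq> M" "a \<in> L" "x - a \<in> M"
  shows "proj_along L M x = a"
  unfolding proj_along_def
proof (rule the_equality)
  fix b assume b: "b \<in> L \<and> x - b \<in> M"
  have "b - a \<in> L"
    using HP1_diff[OF assms(1)] b assms(4) by blast
  moreover have "b - a \<in> M"
    using HP1_diff[OF assms(2), of "x - a" "x - b"] b assms(5) by simp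
  ultimately show "b = a"
    using HP1_Int[OF assms(1-3), of "b - a"] by simp
qed (use assms in blast)

text \<open>Modulo \<open>\<gamma> (n + 1)\<close> only the component in \<open>\<gamma> n\<close> counts, and it is unchanged; modulo \<open>\<gamma> n\<close> only the
  component in \<open>\<gamma> (n + 1)\<close> counts, and it is multiplied by \<open>l\<close>. This is the form in which the
  recursion can be compared with the geometry of triangles.\<close>
lemma darboux_step_iff:
  assumes "\<gamma> n \<in> HP1" "\<gamma> (n + 1) \<in> HP1" "\<gamma> n \<noteq> \<gamma> (n + 1)"
  shows "y = darboux_step \<gamma> l n x \<longleftrightarrow>
    coset (\<gamma> (n + 1)) y = coset (\<gamma> (n + 1)) x \<and>
    coset (\<gamma> n) y = coset (\<gamma> n) (x \<cdot>\<^sub>r quat_of_complex l)"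
proof -
  obtain a where a: "a \<in> \<gamma> n" "x - a \<in> \<gamma> (n + 1)"
    using HP1_splitting[OF assms] .
  define b c where "b = x - a" and "c = quat_of_complex l"
  have b: "b \<in> \<gamma> (n + 1)"
    using a by (simp add: b_def)
  have "proj_along (\<gamma> n) (\<gamma> (n + 1)) x = a"
    using a by (rule proj_along_eqI[OF assms])
  moreover have "proj_along (\<gamma> (n + 1)) (\<gamma> n) x = b"
    using a b by (intro proj_along_eqI[OF assms(2,1) assms(3)[symmetric]]) (simp_all add: b_def)
  ultimately have step: "darboux_step \<gamma> l n x = a + b \<cdot>\<^sub>r c"
    by (simp add: darboux_step_def c_def)
  have "(a + b \<cdot>\<^sub>r c) - x = b \<cdot>\<^sub>r c - b"
    by (simp add: b_def)
  then have "(a + b \<cdot>\<^sub>r c) - x \<in> \<gamma> (n + 1)"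
    using HP1_diff[OF assms(2) HP1_rscale[OF assms(2) b] b] by metis
  moreover have "(a + b \<cdot>\<^sub>r c) - x \<cdot>\<^sub>r c = a - a \<cdot>\<^sub>r c"
    by (simp add: b_def rscale_diff)
  then have "(a + b \<cdot>\<^sub>r c) - x \<cdot>\<^sub>r c \<in> \<gamma> n"
    using HP1_diff[OF assms(1) a(1) HP1_rscale[OF assms(1) a(1)]] by metis
  ultimately have
    "coset (\<gamma> (n + 1)) (a + b \<cdot>\<^sub>r c) = coset (\<gamma> (n + 1)) x"
    "coset (\<gamma> n) (a + b \<cdot>\<^sub>r c) = coset (\<gamma> n) (x \<cdot>\<^sub>r c)"
    using assms by (simp_all add: coset_eq_iff)
  then show ?thesis
    using coset_eqD[OF assms, of y "a + b \<cdot>\<^sub>r c"] unfolding step c_def[symmetric] by metis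
qed

text \<open>The two-sided version of dependent choice: glue a forward and a backward sequence at \<open>0\<close>.\<close>
lemma dependent_int_choice:
  fixes P :: "int \<Rightarrow> 'a \<Rightarrow> bool"
  assumes zero: "P 0 x0"
    and forward: "\<And>n x. P n x \<Longrightarrow> \<exists>y. P (n + 1) y \<and> R n x y"
    and backward: "\<And>n y. P (n + 1) y \<Longrightarrow> \<exists>x. P n x \<and> R n x y"
  shows "\<exists>f. f 0 = x0 \<and> (\<forall>n. P n (f n)) \<and> (\<forall>n. R n (f n) (f (n + 1)))"
proof -
  have "\<exists>g. \<forall>k. (P (int k) (g k) \<and> (k = 0 \<longrightarrow> g k = x0)) \<and> R (int k) (g k) (g (Suc k))"
  proof (rule dependent_nat_choice)
    fix x k assume "P (int k) x \<and> (k = 0 \<longrightarrow> x = x0)"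
    then show "\<exists>y. (P (int (Suc k)) y \<and> (Suc k = 0 \<longrightarrow> y = x0)) \<and> R (int k) x y"
      using forward[of "int k" x] by (simp add: add.commute)
  qed (use zero in auto)
  then obtain g where g: "P (int k) (g k)" "g 0 = x0" "R (int k) (g k) (g (Suc k))" for k
    by metis
  have "\<exists>h. \<forall>k. (P (- int k) (h k) \<and> (k = 0 \<longrightarrow> h k = x0)) \<and> R (- int (Suc k)) (h (Suc k)) (h k)"
  proof (rule dependent_nat_choice)
    fix y k assume "P (- int k) y \<and> (k = 0 \<longrightarrow> y = x0)"
    then show "\<exists>x. (P (- int (Suc k)) x \<and> (Suc k = 0 \<longrightarrow> x = x0)) \<and> R (- int (Suc k)) x y"
      using backward[of "- int (Suc k)" y] by simp
  qed (use zero in auto)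
  then obtain h where h: "P (- int k) (h k)" "h 0 = x0" "R (- int (Suc k)) (h (Suc k)) (h k)" for k
    by metis
  define f where "f n = (if n \<ge> 0 then g (nat n) else h (nat (- n)))" for n
  have "P n (f n)" for n
    using g(1)[of "nat n"] h(1)[of "nat (- n)"] by (cases "n \<ge> 0") (simp_all add: f_def)
  moreover have "R n (f n) (f (n + 1))" for n
  proof (cases "n \<ge> 0")
    case True
    then show ?thesis
      using g(3)[of "nat n"] by (simp add: f_def nat_add_distrib)
  next
    case False
    define k where "k = nat (- n - 1)"
    have n: "n = - int (Suc k)"
      using False by (simp add: k_def)
    have "f n = h (Suc k)" "f (n + 1) = h k"
      unfolding f_def n using g(2) h(2) by (auto simp: nat_add_distrib)
    then show ?thesis
      using h(3)[of k] n by simp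
  qed
  moreover have "f 0 = x0"
    by (simp add: f_def g)
  ultimately show ?thesis
    by blast
qed

section \<open>Darboux transforms of polygons and of thin cylinders\<close>

text \<open>The three isomorphisms around the white triangle map \<open>e n\<close> to \<open>e (n - 1) \<cdot> p\<close>, then
  to \<open>e (n + 1) \<cdot> q\<inverse> p\<close> (because \<open>e (n - 1) \<equiv> e n\<close> and \<open>e (n + 1) \<equiv> e n \<cdot> q\<close> modulo \<open>\<gamma> n\<close>), and finally to
  \<open>e n \<cdot> q\<inverse> p\<close>.\<close>
lemma thin_cylinder_holonomy_iff:
  assumes "\<And>m. m \<in> {n - 1, n, n + 1} \<Longrightarrow> \<gamma> m \<in> HP1"
    and "\<And>m. m \<in> {n - 1, n, n + 1} \<Longrightarrow> \<eta> m \<in> HP1"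
    and e: "\<And>m. m \<in> {n - 1, n, n + 1} \<Longrightarrow> e m \<in> \<eta> m"
    and "e n \<noteq> 0"
    and ne: "\<eta> (n - 1) \<noteq> \<gamma> (n - 1)" "\<eta> (n + 1) \<noteq> \<gamma> n" "\<eta> n \<noteq> \<gamma> (n + 1)"
    and normalized: "coset (\<gamma> n) (e n) = coset (\<gamma> n) (e (n - 1))"
      "coset (\<gamma> (n + 1)) (e (n + 1)) = coset (\<gamma> (n + 1)) (e n)"
    and p: "coset (\<gamma> (n - 1)) (e n) = coset (\<gamma> (n - 1)) (e (n - 1) \<cdot>\<^sub>r p)"
    and q: "coset (\<gamma> n) (e (n + 1)) = coset (\<gamma> n) (e n \<cdot>\<^sub>r q)" "q \<noteq> 0"
  shows "trivial_holonomy (thin_cylinder I) \<gamma> \<eta> n \<longleftrightarrow> p = q"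
proof -
  have \<gamma>: "\<gamma> (n - 1) \<in> HP1" "\<gamma> n \<in> HP1" "\<gamma> (n + 1) \<in> HP1"
    and \<eta>: "\<eta> (n - 1) \<in> HP1" "\<eta> n \<in> HP1" "\<eta> (n + 1) \<in> HP1"
    using assms by auto
  have holonomy:
    "transport (\<eta> (n + 1)) (\<gamma> (n + 1)) (\<eta> n)
      (transport (\<eta> (n - 1)) (\<gamma> n) (\<eta> (n + 1))
        (transport (\<eta> n) (\<gamma> (n - 1)) (\<eta> (n - 1)) (e n \<cdot>\<^sub>r a))) = e n \<cdot>\<^sub>r (inverse q * p * a)" for a
  proof -
    have 1: "transport (\<eta> n) (\<gamma> (n - 1)) (\<eta> (n - 1)) (e n \<cdot>\<^sub>r a) = e (n - 1) \<cdot>\<^sub>r (p * a)"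
      using coset_rscale[OF \<gamma>(1) p, of a]
      by (intro transport_eqI[OF \<gamma>(1) \<eta>(1) ne(1)] HP1_rscale[OF \<eta>(1)] e)
         (simp_all add: rscale_assoc)
    have "coset (\<gamma> n) (e (n + 1) \<cdot>\<^sub>r (inverse q * p * a)) = coset (\<gamma> n) (e n \<cdot>\<^sub>r q \<cdot>\<^sub>r (inverse q * p * a))"
      using coset_rscale[OF \<gamma>(2) q(1)] .
    also have "\<dots> = coset (\<gamma> n) (e n \<cdot>\<^sub>r (p * a))"
      using q(2) by (simp add: rscale_assoc mult.assoc[symmetric])
    also have "\<dots> = coset (\<gamma> n) (e (n - 1) \<cdot>\<^sub>r (p * a))"
      using coset_rscale[OF \<gamma>(2) normalized(1)] .
    finally have 2: "transport (\<eta> (n - 1)) (\<gamma> n) (\<eta> (n + 1)) (e (n - 1) \<cdot>\<^sub>r (p * a)) =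
        e (n + 1) \<cdot>\<^sub>r (inverse q * p * a)"
      by (intro transport_eqI[OF \<gamma>(2) \<eta>(3) ne(2)] HP1_rscale[OF \<eta>(3)] e) simp_all
    have 3: "transport (\<eta> (n + 1)) (\<gamma> (n + 1)) (\<eta> n) (e (n + 1) \<cdot>\<^sub>r (inverse q * p * a)) =
        e n \<cdot>\<^sub>r (inverse q * p * a)"
      using coset_rscale[OF \<gamma>(3) normalized(2)]
      by (intro transport_eqI[OF \<gamma>(3) \<eta>(2) ne(3)] HP1_rscale[OF \<eta>(2)] e) simp_all
    show ?thesis
      by (simp add: 1 2 3)
  qed
  have "trivial_holonomy (thin_cylinder I) \<gamma> \<eta> n \<longleftrightarrow> (\<forall>a. e n \<cdot>\<^sub>r (inverse q * p * a) = e n \<cdot>\<^sub>r a)"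
    (is "?hol \<longleftrightarrow> ?scal")
  proof
    assume ?hol
    then show ?scal
      using holonomy HP1_rscale[OF \<eta>(2) e[of n]] by (simp add: trivial_holonomy_def thin_cylinder_def)
  next
    assume scal: ?scal
    have "transport (\<eta> (n + 1)) (\<gamma> (n + 1)) (\<eta> n)
        (transport (\<eta> (n - 1)) (\<gamma> n) (\<eta> (n + 1))
          (transport (\<eta> n) (\<gamma> (n - 1)) (\<eta> (n - 1)) x)) = x" if x: "x \<in> \<eta> n" for x
    proof -
      obtain a where "x = e n \<cdot>\<^sub>r a"
        using HP1_multiple[OF \<eta>(2) e x \<open>e n \<noteq> 0\<close>] by blast
      then show ?thesis
        using holonomy[of a] scal by simp
    qed
    then show ?hol
      by (simp add: trivial_holonomy_def thin_cylinder_def)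
  qed
  also have "\<dots> \<longleftrightarrow> (\<forall>a. inverse q * p * a = a)"
  proof -
    have "e n \<cdot>\<^sub>r b = e n \<cdot>\<^sub>r a \<longleftrightarrow> b = a" for a b
      using rscale_eq_0_iff[of "e n" "b - a"] \<open>e n \<noteq> 0\<close> by (simp add: rscale_diff_right)
    then show ?thesis
      by simp
  qed
  also have "\<dots> \<longleftrightarrow> inverse q * p = 1"
    by (metis mult.left_neutral mult.right_neutral)
  also have "\<dots> \<longleftrightarrow> p = q"
    using q(2) by (metis left_inverse mult.assoc mult.left_neutral mult.right_neutral right_inverse)
  finally show ?thesis .
qed

lemma curve_darboux_imp_surface_darboux:
  assumes "polygon I \<gamma>" "discrete_curve I \<eta>" "curve_darboux I \<gamma> \<eta>"
  shows "surface_darboux (thin_cylinder I) \<gamma> \<eta>"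
proof -
  have \<gamma>: "\<gamma> n \<in> HP1" and \<eta>: "\<eta> n \<in> HP1" if "n \<in> idx I" for n
    using assms that by (auto simp: polygon_def discrete_curve_def)
  have \<gamma>ne: "\<gamma> n \<noteq> \<gamma> (n + 1)" if "n \<in> idx I" "n + 1 \<in> idx I" for n
    using assms(1) that by (auto simp: polygon_def)
  obtain l e where l: "l \<noteq> 0" and lift: "homogeneous_lift I \<eta> e"
    and rec: "\<And>n. n \<in> idx I \<Longrightarrow> n + 1 \<in> idx I \<Longrightarrow> e (n + 1) = darboux_step \<gamma> l n (e n)"
    and ne0: "\<And>n. n \<in> idx I \<Longrightarrow> \<eta> n \<noteq> \<gamma> n"
    and ne1: "\<And>n. n \<in> idx I \<Longrightarrow> n + 1 \<in> idx I \<Longrightarrow> \<eta> n \<noteq> \<gamma> (n + 1)"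
    using assms(3) unfolding curve_darboux_def by blast
  define c where "c = quat_of_complex l"
  have c: "c \<noteq> 0"
    using l by (simp add: c_def)
  have e: "e n \<in> \<eta> n" "e n \<noteq> 0" if "n \<in> idx I" for n
    using lift that by (auto simp: homogeneous_lift_def)
  have cong: "coset (\<gamma> (n + 1)) (e (n + 1)) = coset (\<gamma> (n + 1)) (e n)"
      "coset (\<gamma> n) (e (n + 1)) = coset (\<gamma> n) (e n \<cdot>\<^sub>r c)"
    if "n \<in> idx I" "n + 1 \<in> idx I" for n
    using darboux_step_iff[of \<gamma> n "e (n + 1)" l "e n"] rec[of n] \<gamma> \<gamma>ne[of n] that
    by (simp_all add: c_def)
  \<comment> \<open>The vertex \<open>n\<close> of the black triangle \<open>n + 1\<close> needs \<open>\<eta> (n + 1) \<noteq> \<gamma> n\<close>, which is not part of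
    the definition for curves but follows from \<open>e (n + 1) \<equiv> e n \<cdot> l\<close>, as \<open>l \<noteq> 0\<close>.\<close>
  have ne2: "\<eta> (n + 1) \<noteq> \<gamma> n" if n: "n \<in> idx I" "n + 1 \<in> idx I" for n
  proof
    assume "\<eta> (n + 1) = \<gamma> n"
    then have "coset (\<gamma> n) (e n \<cdot>\<^sub>r c) = coset (\<gamma> n) 0"
      using e(1)[OF n(2)] cong(2)[OF n] \<gamma>[OF n(1)] by (metis coset_eq_0_iff)
    then show False
      using HP1_nonzero_coset[OF \<gamma>[OF n(1)] \<eta>[OF n(1)] ne0[OF n(1)], of "e n \<cdot>\<^sub>r c"]
        HP1_rscale[OF \<eta>[OF n(1)] e(1)[OF n(1)]] e(2)[OF n(1)] c by simp
  qed
  have "trivial_holonomy (thin_cylinder I) \<gamma> \<eta> n"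
    if n: "n - 1 \<in> idx I" "n \<in> idx I" "n + 1 \<in> idx I" for n
    using thin_cylinder_holonomy_iff[of n \<gamma> \<eta> e c c I] n \<gamma> \<eta> e c ne0 ne1 ne2
      cong[of "n - 1"] cong[of n] by auto
  moreover have "\<eta> b \<noteq> \<gamma> v" if "b \<in> idx I" "v \<in> {b, b + 1, b - 1} \<inter> idx I" for b v
    using that ne0 ne1 ne2[of "b - 1"] by auto
  ultimately show ?thesis
    using \<eta> unfolding surface_darboux_def by (auto simp: thin_cylinder_def)
qed

text \<open>The converse starts from the unique lift, up to a constant right factor, which satisfies
  the first of the two congruences. On an index set which is an interval, the factors
  \<open>q n\<close> in the second congruence are then forced to be one quaternion.\<close>
lemma surface_darboux_imp_curve_darboux:
  assumes I: "is_interval I" and "polygon I \<gamma>" "discrete_curve I \<eta>"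
    and sd: "surface_darboux (thin_cylinder I) \<gamma> \<eta>"
  shows "curve_darboux I \<gamma> \<eta>"
proof -
  have \<gamma>: "\<gamma> n \<in> HP1" and \<eta>: "\<eta> n \<in> HP1" if "n \<in> idx I" for n
    using assms that by (auto simp: polygon_def discrete_curve_def)
  have \<gamma>ne: "\<gamma> n \<noteq> \<gamma> (n + 1)" if "n \<in> idx I" "n + 1 \<in> idx I" for n
    using assms(2) that by (auto simp: polygon_def)
  have ne: "\<eta> b \<noteq> \<gamma> v" if "b \<in> idx I" "v \<in> idx I" "v \<in> {b, b + 1, b - 1}" for b v
    using sd that unfolding surface_darboux_def by (auto simp: thin_cylinder_def)
  have hol: "trivial_holonomy (thin_cylinder I) \<gamma> \<eta> n"
    if "n - 1 \<in> idx I" "n \<in> idx I" "n + 1 \<in> idx I" for n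
    using sd that unfolding surface_darboux_def by (auto simp: thin_cylinder_def)
  have between: "m \<in> idx I" if "a \<in> idx I" "b \<in> idx I" "a \<le> m" "m \<le> b" for a b m
    using mem_is_interval_1_I[OF I, of "real_of_int a" "real_of_int b" "real_of_int m"] that
    by (simp add: idx_def)

  define P where "P n x \<longleftrightarrow> (n \<in> idx I \<longrightarrow> x \<in> \<eta> n \<and> x \<noteq> 0)" for n x
  define R where "R n x y \<longleftrightarrow> (n \<in> idx I \<longrightarrow> n + 1 \<in> idx I \<longrightarrow>
    coset (\<gamma> (n + 1)) y = coset (\<gamma> (n + 1)) x)" for n x y
  have P_ex: "\<exists>x. P n x" for n
    unfolding P_def using \<eta>[of n] by (metis HP1_cases)
  obtain x0 where "P 0 x0"
    using P_ex by blast
  then have "\<exists>e. e 0 = x0 \<and> (\<forall>n. P n (e n)) \<and> (\<forall>n. R n (e n) (e (n + 1)))"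
  proof (rule dependent_int_choice)
    fix n x assume x: "P n x"
    show "\<exists>y. P (n + 1) y \<and> R n x y"
    proof (cases "n \<in> idx I \<and> n + 1 \<in> idx I")
      case True
      then obtain y where "y \<in> \<eta> (n + 1)" "y \<noteq> 0" "coset (\<gamma> (n + 1)) y = coset (\<gamma> (n + 1)) x"
        using nonzero_coset_representative[of "\<gamma> (n + 1)" "\<eta> n" "\<eta> (n + 1)" x] x \<gamma> \<eta> ne
        by (auto simp: P_def)
      then show ?thesis
        unfolding P_def R_def by metis
    qed (use P_ex[of "n + 1"] in \<open>auto simp: R_def\<close>)
  next
    fix n y assume y: "P (n + 1) y"
    show "\<exists>x. P n x \<and> R n x y"
    proof (cases "n \<in> idx I \<and> n + 1 \<in> idx I")
      case True
      then obtain x where "x \<in> \<eta> n" "x \<noteq> 0" "coset (\<gamma> (n + 1)) x = coset (\<gamma> (n + 1)) y"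
        using nonzero_coset_representative[of "\<gamma> (n + 1)" "\<eta> (n + 1)" "\<eta> n" y] y \<gamma> \<eta> ne
        by (auto simp: P_def)
      then show ?thesis
        unfolding P_def R_def by metis
    qed (use P_ex[of n] in \<open>auto simp: R_def\<close>)
  qed
  then obtain e where "P n (e n)" "R n (e n) (e (n + 1))" for n
    by blast
  then have e: "\<And>n. n \<in> idx I \<Longrightarrow> e n \<in> \<eta> n" "\<And>n. n \<in> idx I \<Longrightarrow> e n \<noteq> 0"
    and e1: "\<And>n. n \<in> idx I \<Longrightarrow> n + 1 \<in> idx I \<Longrightarrow>
      coset (\<gamma> (n + 1)) (e (n + 1)) = coset (\<gamma> (n + 1)) (e n)"
    by (auto simp: P_def R_def)

  have "\<exists>q. q \<noteq> 0 \<and> coset (\<gamma> n) (e (n + 1)) = coset (\<gamma> n) (e n \<cdot>\<^sub>r q)"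
    if n: "n \<in> idx I" "n + 1 \<in> idx I" for n
  proof -
    obtain y where y: "y \<in> \<eta> n" "y \<noteq> 0" "coset (\<gamma> n) y = coset (\<gamma> n) (e (n + 1))"
      using nonzero_coset_representative[of "\<gamma> n" "\<eta> (n + 1)" "\<eta> n" "e (n + 1)"] n \<gamma> \<eta> ne e by auto
    obtain q where "y = e n \<cdot>\<^sub>r q"
      using HP1_multiple[OF \<eta> e(1) y(1) e(2)] n(1) by blast
    then show ?thesis
      using y by auto
  qed
  then obtain q where q: "\<And>n. n \<in> idx I \<Longrightarrow> n + 1 \<in> idx I \<Longrightarrow>
      q n \<noteq> 0 \<and> coset (\<gamma> n) (e (n + 1)) = coset (\<gamma> n) (e n \<cdot>\<^sub>r q n)"
    by metis
  have q_step: "q n = q (n - 1)" if n: "n - 1 \<in> idx I" "n \<in> idx I" "n + 1 \<in> idx I" for n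
  proof -
    have "trivial_holonomy (thin_cylinder I) \<gamma> \<eta> n \<longleftrightarrow> q (n - 1) = q n"
      by (rule thin_cylinder_holonomy_iff[where e = e])
         (use n \<gamma> \<eta> e ne e1[of "n - 1"] e1[of n] q[of "n - 1"] q[of n] in auto)
    then show ?thesis
      using hol[OF n] by simp
  qed
  have q_le: "q m = q a"
    if "a \<le> m" "a \<in> idx I" "m \<in> idx I" "m + 1 \<in> idx I" for a m
    using that
  proof (induction m rule: int_ge_induct)
    case (step m)
    have "m \<in> idx I" "m + 1 \<in> idx I"
      using between[OF step.prems(1,3)] step.hyps by auto
    then show ?case
      using step q_step[of "m + 1"] by auto
  qed simp
  obtain p where p: "p \<noteq> 0" "\<And>n. n \<in> idx I \<Longrightarrow> n + 1 \<in> idx I \<Longrightarrow> q n = p"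
  proof (cases "\<exists>n. n \<in> idx I \<and> n + 1 \<in> idx I")
    case True
    then obtain a where a: "a \<in> idx I" "a + 1 \<in> idx I"
      by blast
    have "q n = q a" if "n \<in> idx I" "n + 1 \<in> idx I" for n
      using q_le[of a n] q_le[of n a] a that by (cases "a \<le> n") auto
    then show ?thesis
      using that q[OF a] by blast
  next
    case False
    then show ?thesis
      using that[of 1] by auto
  qed

  \<comment> \<open>The remaining freedom in the choice of the lift conjugates \<open>p\<close> to a complex number.\<close>
  obtain u l where u: "u \<noteq> 0" and ul: "p * u = u * quat_of_complex l"
    by (rule quat_conjugate_to_complex)
  have "l \<noteq> 0"
    using ul u p(1) by (metis mult_eq_0_iff quat_of_complex_0)
  moreover have "homogeneous_lift I \<eta> (\<lambda>n. e n \<cdot>\<^sub>r u)"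
    using e \<eta> u HP1_rscale by (auto simp: homogeneous_lift_def)
  moreover have "e (n + 1) \<cdot>\<^sub>r u = darboux_step \<gamma> l n (e n \<cdot>\<^sub>r u)"
    if n: "n \<in> idx I" "n + 1 \<in> idx I" for n
  proof -
    have "coset (\<gamma> n) (e (n + 1)) = coset (\<gamma> n) (e n \<cdot>\<^sub>r p)"
      using q[OF n] p(2)[OF n] by simp
    then have "coset (\<gamma> n) (e (n + 1) \<cdot>\<^sub>r u) = coset (\<gamma> n) (e n \<cdot>\<^sub>r u \<cdot>\<^sub>r quat_of_complex l)"
      using coset_rscale[OF \<gamma>[OF n(1)]] by (metis rscale_assoc ul)
    then show ?thesis
      using coset_rscale[OF \<gamma>[OF n(2)] e1[OF n]]
      by (subst darboux_step_iff[OF \<gamma>[OF n(1)] \<gamma>[OF n(2)] \<gamma>ne[OF n]]) simp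
  qed
  ultimately have "\<exists>l e. l \<noteq> 0 \<and> homogeneous_lift I \<eta> e \<and>
      (\<forall>n \<in> idx I. n + 1 \<in> idx I \<longrightarrow> e (n + 1) = darboux_step \<gamma> l n (e n))"
    by blast
  then show ?thesis
    unfolding curve_darboux_def using ne by simp
qed

section \<open>The holonomy of a closed polygon\<close>

lemma closed_polygon_facts:
  assumes "closed_polygon N \<gamma>"
  shows "\<gamma> n \<in> HP1" "\<gamma> n \<noteq> \<gamma> (n + 1)" "\<gamma> (n + int N) = \<gamma> n"
  using assms by (auto simp: closed_polygon_def polygon_def discrete_curve_def idx_def)

lemma closed_polygon_mod:
  assumes "closed_polygon N \<gamma>"
  shows "\<gamma> (n mod int N) = \<gamma> n"
proof -
  have "\<gamma> (n + k * int N) = \<gamma> n" for n k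
  proof (induction k rule: int_induct[where k = 0])
    case (step1 i)
    then show ?case
      using closed_polygon_facts(3)[OF assms, of "n + i * int N"] by (simp add: algebra_simps)
  next
    case (step2 i)
    then show ?case
      using closed_polygon_facts(3)[OF assms, of "n + (i - 1) * int N"] by (simp add: algebra_simps)
  qed simp
  from this[of "n mod int N" "n div int N"] show ?thesis
    by simp
qed

lemma closed_polygon_step_iff:
  assumes "closed_polygon N \<gamma>"
  shows "y = darboux_step \<gamma> l n x \<longleftrightarrow>
    coset (\<gamma> (n + 1)) y = coset (\<gamma> (n + 1)) x \<and>
    coset (\<gamma> n) y = coset (\<gamma> n) (x \<cdot>\<^sub>r quat_of_complex l)"
  by (rule darboux_step_iff) (use closed_polygon_facts[OF assms] in auto)

lemma coset_darboux_step:
  assumes "closed_polygon N \<gamma>"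
  shows "coset (\<gamma> (n + 1)) (darboux_step \<gamma> l n x) = coset (\<gamma> (n + 1)) x"
    and "coset (\<gamma> n) (darboux_step \<gamma> l n x) = coset (\<gamma> n) (x \<cdot>\<^sub>r quat_of_complex l)"
  using closed_polygon_step_iff[OF assms, of "darboux_step \<gamma> l n x" l n x] by simp_all

lemma darboux_step_periodic:
  assumes "closed_polygon N \<gamma>"
  shows "darboux_step \<gamma> l (n + int N) = darboux_step \<gamma> l n"
  using closed_polygon_facts(3)[OF assms, of n] closed_polygon_facts(3)[OF assms, of "n + 1"]
  by (simp add: darboux_step_def fun_eq_iff algebra_simps)

lemma darboux_step_add:
  assumes "closed_polygon N \<gamma>"
  shows "darboux_step \<gamma> l n (x + y) = darboux_step \<gamma> l n x + darboux_step \<gamma> l n y"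
proof (rule sym, subst closed_polygon_step_iff[OF assms], intro conjI)
  note step = coset_darboux_step[OF assms]
  note line = closed_polygon_facts(1)[OF assms]
  show "coset (\<gamma> (n + 1)) (darboux_step \<gamma> l n x + darboux_step \<gamma> l n y) = coset (\<gamma> (n + 1)) (x + y)"
    by (rule coset_add[OF line]) (use step in auto)
  show "coset (\<gamma> n) (darboux_step \<gamma> l n x + darboux_step \<gamma> l n y) =
      coset (\<gamma> n) ((x + y) \<cdot>\<^sub>r quat_of_complex l)"
    unfolding rscale_add by (rule coset_add[OF line]) (use step in auto)
qed

text \<open>The scalar has to be complex, because it must commute with \<open>l\<close>.\<close>
lemma darboux_step_rscale:
  assumes "closed_polygon N \<gamma>"
  shows "darboux_step \<gamma> l n (x \<cdot>\<^sub>r quat_of_complex c) = darboux_step \<gamma> l n x \<cdot>\<^sub>r quat_of_complex c"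
proof (rule sym, subst closed_polygon_step_iff[OF assms], intro conjI)
  note step = coset_darboux_step[OF assms]
  note line = closed_polygon_facts(1)[OF assms]
  show "coset (\<gamma> (n + 1)) (darboux_step \<gamma> l n x \<cdot>\<^sub>r quat_of_complex c) =
      coset (\<gamma> (n + 1)) (x \<cdot>\<^sub>r quat_of_complex c)"
    by (rule coset_rscale[OF line]) (use step in auto)
  show "coset (\<gamma> n) (darboux_step \<gamma> l n x \<cdot>\<^sub>r quat_of_complex c) =
      coset (\<gamma> n) (x \<cdot>\<^sub>r quat_of_complex c \<cdot>\<^sub>r quat_of_complex l)"
    unfolding rscale_complex_commute[of x c l] by (rule coset_rscale[OF line]) (use step in auto)
qed

lemma darboux_step_inj:
  assumes "closed_polygon N \<gamma>" "l \<noteq> 0" "darboux_step \<gamma> l n x = darboux_step \<gamma> l n y"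
  shows "x = y"
proof -
  note step = coset_darboux_step[OF assms(1), of n l]
  note line = closed_polygon_facts(1)[OF assms(1)]
  have "coset (\<gamma> n) x = coset (\<gamma> n) y"
    using step(2)[of x] step(2)[of y] assms(2,3)
      coset_rscale_iff[OF line[of n], of "quat_of_complex l" x y] by simp
  moreover have "coset (\<gamma> (n + 1)) x = coset (\<gamma> (n + 1)) y"
    using step(1)[of x] step(1)[of y] assms(3) by simp
  ultimately show ?thesis
    by (rule coset_eqD[OF line line closed_polygon_facts(2)[OF assms(1)]])
qed

lemma darboux_step_surj:
  assumes "closed_polygon N \<gamma>" "l \<noteq> 0"
  obtains x where "y = darboux_step \<gamma> l n x"
proof -
  note line = closed_polygon_facts(1)[OF assms(1)]
  obtain x where x: "coset (\<gamma> n) x = coset (\<gamma> n) (y \<cdot>\<^sub>r quat_of_complex (inverse l))"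
    "coset (\<gamma> (n + 1)) x = coset (\<gamma> (n + 1)) y"
    by (rule coset_simultaneous[OF line line closed_polygon_facts(2)[OF assms(1)]])
  have "coset (\<gamma> n) (x \<cdot>\<^sub>r quat_of_complex l) = coset (\<gamma> n) y"
    using coset_rscale[OF line x(1), of "quat_of_complex l"] assms(2)
    by (simp add: rscale_assoc quat_of_complex_mult[symmetric])
  then have "y = darboux_step \<gamma> l n x"
    using x(2) by (simp add: closed_polygon_step_iff[OF assms(1)])
  then show ?thesis
    by (rule that)
qed

text \<open>For \<open>l \<noteq> 0\<close> the steps are injective, so that the recursion can also be followed backwards.
  Below, this shows that a solution vanishes if \<open>x 0 = 0\<close>, and that \<open>x (n + N) = x n \<cdot> m\<close> holds for
  all \<open>n\<close> if it holds for \<open>n = 0\<close>.\<close>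
lemma darboux_sequence_unique:
  assumes "closed_polygon N \<gamma>" "l \<noteq> 0"
    and "\<And>n. x (n + 1) = darboux_step \<gamma> l n (x n)" "\<And>n. y (n + 1) = darboux_step \<gamma> l n (y n)"
    and "x 0 = y 0"
  shows "x n = y n"
proof (induction n rule: int_induct[where k = 0])
  case (step2 i)
  then have "darboux_step \<gamma> l (i - 1) (x (i - 1)) = darboux_step \<gamma> l (i - 1) (y (i - 1))"
    using assms(3)[of "i - 1"] assms(4)[of "i - 1"] by simp
  then show ?case
    by (rule darboux_step_inj[OF assms(1,2)])
qed (use assms in simp_all)

lemma curve_holonomy_darboux_sequence:
  assumes "\<And>n. x (n + 1) = darboux_step \<gamma> l n (x n)"
  shows "curve_holonomy \<gamma> l k (x 0) = x (int k)"
  by (induction k) (simp_all add: assms[symmetric] add.commute)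

lemma curve_holonomy_add:
  assumes "closed_polygon N \<gamma>"
  shows "curve_holonomy \<gamma> l k (x + y) = curve_holonomy \<gamma> l k x + curve_holonomy \<gamma> l k y"
  by (induction k) (simp_all add: darboux_step_add[OF assms])

lemma curve_holonomy_rscale:
  assumes "closed_polygon N \<gamma>"
  shows "curve_holonomy \<gamma> l k (x \<cdot>\<^sub>r quat_of_complex c) = curve_holonomy \<gamma> l k x \<cdot>\<^sub>r quat_of_complex c"
  by (induction k) (simp_all add: darboux_step_rscale[OF assms])

lemma cdet_eq_0_iff:
  assumes add: "\<And>x y. T (x + y) = T x + T y"
    and scale: "\<And>x c. T (x \<cdot>\<^sub>r quat_of_complex c) = T x \<cdot>\<^sub>r quat_of_complex c"
  shows "cdet T = 0 \<longleftrightarrow> (\<exists>x. x \<noteq> 0 \<and> T x = 0)"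
proof -
  have of_add: "of_C4 (a + b) = of_C4 a + of_C4 b" for a b
    by (metis of_C4_to_C4 to_C4_add to_C4_of_C4)
  have of_scale: "of_C4 (c *s a) = of_C4 a \<cdot>\<^sub>r quat_of_complex c" for c a
    by (metis of_C4_to_C4 to_C4_rscale to_C4_of_C4)
  have "Vector_Spaces.linear (*s) (*s) (to_C4 \<circ> T \<circ> of_C4)"
    by (simp add: Vector_Spaces.linear_iff vec.vector_space_axioms of_add of_scale add scale to_C4_add to_C4_rscale)
  then have "cdet T \<noteq> 0 \<longleftrightarrow> inj (to_C4 \<circ> T \<circ> of_C4)"
    unfolding cdet_def by (rule det_nz_iff_inj_gen)
  also have "\<dots> \<longleftrightarrow> inj T"
  proof
    have inj: "inj to_C4" "inj of_C4"
      by (metis injI of_C4_to_C4, metis injI to_C4_of_C4)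
    show "inj (to_C4 \<circ> T \<circ> of_C4)" if "inj T"
      using inj that by (intro inj_compose)
    assume "inj (to_C4 \<circ> T \<circ> of_C4)"
    then have "inj (of_C4 \<circ> (to_C4 \<circ> T \<circ> of_C4) \<circ> to_C4)"
      by (rule inj_compose[OF inj_compose[OF inj(2)] inj(1)])
    moreover have "of_C4 \<circ> (to_C4 \<circ> T \<circ> of_C4) \<circ> to_C4 = T"
      by (simp add: fun_eq_iff of_C4_to_C4)
    ultimately show "inj T"
      by simp
  qed
  also have "\<dots> \<longleftrightarrow> (\<forall>x. T x = 0 \<longrightarrow> x = 0)"
  proof -
    interpret additive T
      by standard (rule add)
    show ?thesis
      unfolding inj_def by (metis diff zero right_minus_eq)
  qed
  finally show ?thesis
    by blast
qed

lemma holonomy_eigenvalue_iff: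
  assumes "closed_polygon N \<gamma>"
  shows "cdet (\<lambda>x. x \<cdot>\<^sub>r quat_of_complex m - curve_holonomy \<gamma> l N x) = 0 \<longleftrightarrow>
    (\<exists>x. x \<noteq> 0 \<and> curve_holonomy \<gamma> l N x = x \<cdot>\<^sub>r quat_of_complex m)"
proof -
  let ?T = "\<lambda>x. x \<cdot>\<^sub>r quat_of_complex m - curve_holonomy \<gamma> l N x"
  have "?T (x + y) = ?T x + ?T y" for x y
    by (simp add: curve_holonomy_add[OF assms] rscale_add)
  moreover have "?T (x \<cdot>\<^sub>r quat_of_complex c) = ?T x \<cdot>\<^sub>r quat_of_complex c" for x c
    unfolding curve_holonomy_rscale[OF assms] rscale_diff rscale_complex_commute[of x c m] ..
  ultimately have "cdet ?T = 0 \<longleftrightarrow> (\<exists>x. x \<noteq> 0 \<and> ?T x = 0)"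
    by (rule cdet_eq_0_iff)
  moreover have "?T x = 0 \<longleftrightarrow> curve_holonomy \<gamma> l N x = x \<cdot>\<^sub>r quat_of_complex m" for x
    by auto
  ultimately show ?thesis
    by simp
qed

section \<open>The spectrum of a thin torus\<close>

text \<open>The lifts of a holomorphic section on the black triangles \<open>(n, 0)\<close> form a solution of the recursion
  whose initial value is an eigenvector.\<close>
lemma spectrum_imp_eigenvalue:
  assumes \<gamma>: "closed_polygon N \<gamma>"
    and h: "h \<in> spectrum (thin_cover UNIV) (range (deck N)) (\<gamma> \<circ> thin_torus_vertex N)"
  defines "m \<equiv> h (deck N (1, 0))" and "l \<equiv> h (deck N (0, 1))"
  shows "m \<noteq> 0" "l \<noteq> 0" "\<exists>x. x \<noteq> 0 \<and> curve_holonomy \<gamma> l N x = x \<cdot>\<^sub>r quat_of_complex m"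
proof -
  note line = closed_polygon_facts(1)[OF \<gamma>]
  have F: "(\<gamma> \<circ> thin_torus_vertex N) (n, k) = \<gamma> n" for n k
    by (simp add: thin_torus_vertex_def closed_polygon_mod[OF \<gamma>])
  have h0: "h (deck N ab) \<noteq> 0" for ab
    using h unfolding spectrum_def multiplicative_character_def by blast
  show m: "m \<noteq> 0" and l: "l \<noteq> 0"
    by (auto simp: m_def l_def h0)
  obtain \<psi> where hol: "holomorphic_section (thin_cover UNIV) (\<gamma> \<circ> thin_torus_vertex N) \<psi>"
    and nontriv: "nontrivial_section (thin_cover UNIV) (\<gamma> \<circ> thin_torus_vertex N) \<psi>"
    and mono: "has_monodromy (thin_cover UNIV) (range (deck N)) h \<psi>"
    using h by (auto simp: spectrum_def)
  have mono': "\<psi> (n + a * int N, k + b) = (\<lambda>x. x \<cdot>\<^sub>r quat_of_complex (h (deck N (a, b)))) ` \<psi> (n, k)"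
    for a b n k
    using mono by (auto simp: has_monodromy_def thin_cover_def idx_def deck_def)
  have "\<exists>x. \<psi> (n, 0) = coset (\<gamma> n) x \<and> \<psi> (n + 1, 0) = coset (\<gamma> (n + 1)) x \<and>
      \<psi> (n - 1, 1) = coset (\<gamma> (n - 1)) x" for n
  proof -
    have "(n, 0) \<in> Black (thin_cover UNIV)"
      by (simp add: thin_cover_def idx_def)
    then obtain x where "\<forall>v \<in> bvert (thin_cover UNIV) (n, 0). \<psi> v = coset ((\<gamma> \<circ> thin_torus_vertex N) v) x"
      using hol unfolding holomorphic_section_def by blast
    then have "\<forall>v \<in> {(n, 0), (n + 1, 0), (n - 1, 1)}. \<psi> v = coset ((\<gamma> \<circ> thin_torus_vertex N) v) x"
      by (simp add: thin_cover_def idx_def)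
    then have "\<psi> (n, 0) = coset (\<gamma> n) x \<and> \<psi> (n + 1, 0) = coset (\<gamma> (n + 1)) x \<and>
        \<psi> (n - 1, 1) = coset (\<gamma> (n - 1)) x"
      by (simp only: ball_simps F simp_thms)
    then show ?thesis
      by (rule exI)
  qed
  then obtain x where x: "\<And>n. \<psi> (n, 0) = coset (\<gamma> n) (x n)"
    "\<And>n. \<psi> (n + 1, 0) = coset (\<gamma> (n + 1)) (x n)" "\<And>n. \<psi> (n - 1, 1) = coset (\<gamma> (n - 1)) (x n)"
    by metis
  have vertical: "\<psi> (n, 1) = coset (\<gamma> n) (x n \<cdot>\<^sub>r quat_of_complex l)" for n
    using mono'[of n 0 0 1] l by (simp add: x(1) l_def rscale_image_coset[OF line])
  have rec: "x (n + 1) = darboux_step \<gamma> l n (x n)" for n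
    unfolding closed_polygon_step_iff[OF \<gamma>]
    using x(1)[of "n + 1"] x(2)[of n] x(3)[of "n + 1"] vertical[of n] by simp
  have "x (int N) = x 0 \<cdot>\<^sub>r quat_of_complex m"
  proof (rule coset_eqD[OF line line closed_polygon_facts(2)[OF \<gamma>]])
    show "coset (\<gamma> 0) (x (int N)) = coset (\<gamma> 0) (x 0 \<cdot>\<^sub>r quat_of_complex m)"
      using mono'[of 0 1 0 0] m x(1)[of "int N"] closed_polygon_facts(3)[OF \<gamma>, of 0]
      by (simp add: x(1)[of 0] m_def rscale_image_coset[OF line])
    show "coset (\<gamma> (0 + 1)) (x (int N)) = coset (\<gamma> (0 + 1)) (x 0 \<cdot>\<^sub>r quat_of_complex m)"
      using mono'[of 1 1 0 0] m x(2)[of "int N"] x(2)[of 0] closed_polygon_facts(3)[OF \<gamma>, of 1]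
      by (simp add: m_def rscale_image_coset[OF line] add.commute)
  qed
  then have "curve_holonomy \<gamma> l N (x 0) = x 0 \<cdot>\<^sub>r quat_of_complex m"
    using curve_holonomy_darboux_sequence[of x \<gamma> l N, OF rec] by simp
  moreover have "x 0 \<noteq> 0"
  proof
    assume "x 0 = 0"
    \<comment> \<open>Then \<open>x\<close> agrees with the solution \<open>0\<close>, and \<open>\<psi>\<close> is trivial.\<close>
    have "0 = darboux_step \<gamma> l n 0" for n
      unfolding closed_polygon_step_iff[OF \<gamma>] by simp
    then have "x n = 0" for n
      using darboux_sequence_unique[where x = x and y = "\<lambda>_. 0", OF \<gamma> l rec] \<open>x 0 = 0\<close> by blast
    then have "\<psi> (n, k) = coset (\<gamma> n) 0" for n k
      using mono'[of n 0 0 k] x(1)[of n] h0 by (simp add: rscale_image_coset[OF line])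
    moreover obtain v where "\<psi> v \<noteq> coset ((\<gamma> \<circ> thin_torus_vertex N) v) 0"
      using nontriv unfolding nontrivial_section_def by blast
    ultimately show False
      by (cases v) (simp add: F del: o_apply)
  qed
  ultimately show "\<exists>x. x \<noteq> 0 \<and> curve_holonomy \<gamma> l N x = x \<cdot>\<^sub>r quat_of_complex m"
    by blast
qed

lemma deck_comp: "deck N (a, b) \<circ> deck N (a', b') = deck N (a + a', b + b')"
  by (auto simp: deck_def fun_eq_iff algebra_simps)

lemma inj_deck:
  assumes "0 < N"
  shows "inj (deck N)"
proof
  fix p q assume eq: "deck N p = deck N q"
  have "deck N p (0, 0) = deck N q (0, 0)"
    by (simp add: eq)
  then show "p = q"
    using assms by (cases p; cases q) (simp add: deck_def)
qed

text \<open>Conversely, an eigenvector of the holonomy extends to a solution \<open>x\<close> of the recursion which is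
  multiplied by \<open>m\<close> under the shift by \<open>N\<close>, and \<open>\<psi> (n, k)\<close> is the class of \<open>x n \<cdot> l\<^sup>k\<close>, with \<open>x n \<cdot> l\<^sup>k\<close>
  as the lift on the black triangle \<open>(n, k)\<close>.\<close>
lemma eigenvalue_imp_spectrum:
  assumes \<gamma>: "closed_polygon N \<gamma>" and m: "m \<noteq> 0" and l: "l \<noteq> 0"
    and x0: "x0 \<noteq> 0" "curve_holonomy \<gamma> l N x0 = x0 \<cdot>\<^sub>r quat_of_complex m"
  obtains h where "h \<in> spectrum (thin_cover UNIV) (range (deck N)) (\<gamma> \<circ> thin_torus_vertex N)"
    and "h (deck N (1, 0)) = m" and "h (deck N (0, 1)) = l"
proof -
  note line = closed_polygon_facts(1)[OF \<gamma>]
  have F: "(\<gamma> \<circ> thin_torus_vertex N) (n, k) = \<gamma> n" for n k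
    by (simp add: thin_torus_vertex_def closed_polygon_mod[OF \<gamma>])
  have N: "0 < N"
    using \<gamma> by (simp add: closed_polygon_def)
  have "\<exists>x. x 0 = x0 \<and> (\<forall>n::int. True) \<and> (\<forall>n. x (n + 1) = darboux_step \<gamma> l n (x n))"
    by (rule dependent_int_choice) (use darboux_step_surj[OF \<gamma> l] in blast)+
  then obtain x where x_0: "x 0 = x0" and rec: "\<And>n. x (n + 1) = darboux_step \<gamma> l n (x n)"
    by blast
  have x_period: "x (n + int N) = x n \<cdot>\<^sub>r quat_of_complex m" for n
  proof (rule darboux_sequence_unique[OF \<gamma> l])
    show "x (0 + int N) = x 0 \<cdot>\<^sub>r quat_of_complex m"
      using curve_holonomy_darboux_sequence[of x \<gamma> l N, OF rec] x0(2) x_0 by simp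
    show "x (n + 1 + int N) = darboux_step \<gamma> l n (x (n + int N))" for n
      using rec[of "n + int N"] by (simp add: darboux_step_periodic[OF \<gamma>] algebra_simps)
    show "x (n + 1) \<cdot>\<^sub>r quat_of_complex m = darboux_step \<gamma> l n (x n \<cdot>\<^sub>r quat_of_complex m)" for n
      by (simp add: rec darboux_step_rscale[OF \<gamma>])
  qed
  have x_shift: "x (n + a * int N) = x n \<cdot>\<^sub>r quat_of_complex (m powi a)" for n a
  proof (induction a rule: int_induct[where k = 0])
    case (step1 a)
    then show ?case
      using x_period[of "n + a * int N"] m
      by (simp add: power_int_add algebra_simps rscale_assoc quat_of_complex_mult[symmetric])
  next
    case (step2 a)
    have "x (n + (a - 1) * int N) \<cdot>\<^sub>r quat_of_complex m = x n \<cdot>\<^sub>r quat_of_complex (m powi a)"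
      using x_period[of "n + (a - 1) * int N"] step2 by (simp add: algebra_simps)
    also have "\<dots> = x n \<cdot>\<^sub>r quat_of_complex (m powi (a - 1)) \<cdot>\<^sub>r quat_of_complex m"
      using m by (simp add: power_int_diff rscale_assoc quat_of_complex_mult[symmetric])
    finally show ?case
      using m by (simp add: rscale_cancel)
  qed simp

  define h where "h g = (case inv (deck N) g of (a, b) \<Rightarrow> m powi a * l powi b)" for g
  have h: "h (deck N (a, b)) = m powi a * l powi b" for a b
    unfolding h_def inv_f_f[OF inj_deck[OF N]] by simp
  define \<psi> where "\<psi> = (\<lambda>(n, k). coset (\<gamma> n) (x n \<cdot>\<^sub>r quat_of_complex (l powi k)))"
  have "h (deck N (a, b) \<circ> deck N (a', b')) = h (deck N (a, b)) * h (deck N (a', b'))"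
    and "h (deck N (a, b)) \<noteq> 0" for a b a' b'
    unfolding deck_comp h using m l by (simp_all add: power_int_add mult.assoc mult.left_commute)
  then have "multiplicative_character (range (deck N)) h"
    unfolding multiplicative_character_def by (simp add: split_paired_all)
  moreover have "quotient_section (thin_cover UNIV) (\<gamma> \<circ> thin_torus_vertex N) \<psi>"
    unfolding quotient_section_def by (simp add: F \<psi>_def del: o_apply split: prod.split)
  moreover have "holomorphic_section (thin_cover UNIV) (\<gamma> \<circ> thin_torus_vertex N) \<psi>"
  proof -
    have "\<psi> v = coset ((\<gamma> \<circ> thin_torus_vertex N) v) (x n \<cdot>\<^sub>r quat_of_complex (l powi k))"
      if "v \<in> {(n, k), (n + 1, k), (n - 1, k + 1)}" for n k v
    proof -
      have "coset (\<gamma> (n + 1)) (x (n + 1)) = coset (\<gamma> (n + 1)) (x n)"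
        "coset (\<gamma> (n - 1)) (x n) = coset (\<gamma> (n - 1)) (x (n - 1) \<cdot>\<^sub>r quat_of_complex l)"
        using rec[of n] rec[of "n - 1"] by (simp_all add: closed_polygon_step_iff[OF \<gamma>])
      from this[THEN coset_rscale[OF line], of "quat_of_complex (l powi k)"]
      have "coset (\<gamma> (n + 1)) (x (n + 1) \<cdot>\<^sub>r quat_of_complex (l powi k)) =
          coset (\<gamma> (n + 1)) (x n \<cdot>\<^sub>r quat_of_complex (l powi k))"
        and "coset (\<gamma> (n - 1)) (x n \<cdot>\<^sub>r quat_of_complex (l powi k)) =
          coset (\<gamma> (n - 1)) (x (n - 1) \<cdot>\<^sub>r quat_of_complex (l powi (k + 1)))"
        using l by (simp_all add: power_int_add_1' rscale_assoc quat_of_complex_mult)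
      then show ?thesis
        using that by (auto simp: F \<psi>_def simp del: o_apply)
    qed
    moreover have "bvert (thin_cover UNIV) (n, k) = {(n, k), (n + 1, k), (n - 1, k + 1)}" for n k
      by (simp add: thin_cover_def idx_def)
    ultimately have "\<forall>v \<in> bvert (thin_cover UNIV) (n, k).
        \<psi> v = coset ((\<gamma> \<circ> thin_torus_vertex N) v) (x n \<cdot>\<^sub>r quat_of_complex (l powi k))" for n k
      by blast
    then show ?thesis
      unfolding holomorphic_section_def by fast
  qed
  moreover have "nontrivial_section (thin_cover UNIV) (\<gamma> \<circ> thin_torus_vertex N) \<psi>"
  proof (rule ccontr)
    \<comment> \<open>The vector \<open>x 0\<close> lies in at most one of the lines \<open>\<gamma> 0\<close> and \<open>\<gamma> 1\<close>, so that \<open>\<psi>\<close> is non-zero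
      at one of the vertices \<open>(0, 0)\<close> and \<open>(1, 0)\<close>.\<close>
    assume "\<not> nontrivial_section (thin_cover UNIV) (\<gamma> \<circ> thin_torus_vertex N) \<psi>"
    moreover have "(n, 0) \<in> Vert (thin_cover UNIV)" for n
      by (simp add: thin_cover_def idx_def)
    ultimately have "\<psi> (n, 0) = coset (\<gamma> n) 0" for n
      unfolding nontrivial_section_def F[of n 0, symmetric] by blast
    then have trivial: "coset (\<gamma> n) (x n) = coset (\<gamma> n) 0" for n
      by (simp add: \<psi>_def)
    have "coset (\<gamma> (0 + 1)) (x (0 + 1)) = coset (\<gamma> (0 + 1)) (x 0)"
      using rec[of 0] unfolding closed_polygon_step_iff[OF \<gamma>] by (rule conjunct1)
    then have "x 0 = 0"
      using trivial[of "0 + 1"]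
      by (intro coset_eqD[OF line line closed_polygon_facts(2)[OF \<gamma>] trivial]) (rule trans[OF sym])
    then show False
      using x0(1) x_0 by simp
  qed
  moreover have "has_monodromy (thin_cover UNIV) (range (deck N)) h \<psi>"
  proof -
    have \<gamma>_shift: "\<gamma> (n + a * int N) = \<gamma> n" for n a
      using closed_polygon_mod[OF \<gamma>, of "n + a * int N"] closed_polygon_mod[OF \<gamma>, of n] by simp
    have "\<psi> (n + a * int N, k + b) =
        (\<lambda>x. x \<cdot>\<^sub>r quat_of_complex (m powi a * l powi b)) ` \<psi> (n, k)" for a b n k
    proof -
      have "m powi a * l powi (k + b) = l powi k * (m powi a * l powi b)"
        using l by (simp add: power_int_add mult.left_commute)
      then have "x (n + a * int N) \<cdot>\<^sub>r quat_of_complex (l powi (k + b)) =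
          x n \<cdot>\<^sub>r quat_of_complex (l powi k) \<cdot>\<^sub>r quat_of_complex (m powi a * l powi b)"
        by (simp only: x_shift rscale_assoc quat_of_complex_mult[symmetric])
      then show ?thesis
        using m l by (simp add: \<psi>_def \<gamma>_shift rscale_image_coset[OF line])
    qed
    then have "\<psi> (deck N (a, b) (n, k)) =
        (\<lambda>x. x \<cdot>\<^sub>r quat_of_complex (h (deck N (a, b)))) ` \<psi> (n, k)" for a b n k
      unfolding h by (simp add: deck_def)
    then show ?thesis
      unfolding has_monodromy_def by fast
  qed
  ultimately have "h \<in> spectrum (thin_cover UNIV) (range (deck N)) (\<gamma> \<circ> thin_torus_vertex N)"
    unfolding spectrum_def by blast
  then show ?thesis
    by (rule that) (simp_all add: h)
qed

lemma spectral_curves_coincide: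
  assumes "closed_polygon N \<gamma>"
  shows "polygon_spectral_curve N \<gamma> = thin_torus_spectral_curve N \<gamma>"
proof -
  have "{(m, l). m \<noteq> 0 \<and> l \<noteq> 0 \<and> (\<exists>x. x \<noteq> 0 \<and> curve_holonomy \<gamma> l N x = x \<cdot>\<^sub>r quat_of_complex m)} =
      (\<lambda>h. (h (deck N (1, 0)), h (deck N (0, 1)))) `
        spectrum (thin_cover UNIV) (range (deck N)) (\<gamma> \<circ> thin_torus_vertex N)"
    (is "?E = ?pair ` ?spec")
  proof
    show "?E \<subseteq> ?pair ` ?spec"
    proof clarify
      fix m l x
      assume "m \<noteq> 0" "l \<noteq> 0" "x \<noteq> 0" "curve_holonomy \<gamma> l N x = x \<cdot>\<^sub>r quat_of_complex m"
      then obtain h where "h \<in> ?spec" "h (deck N (1, 0)) = m" "h (deck N (0, 1)) = l"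
        by (rule eigenvalue_imp_spectrum[OF assms])
      then show "(m, l) \<in> ?pair ` ?spec"
        by (intro image_eqI[of _ _ h]) simp_all
    qed
    show "?pair ` ?spec \<subseteq> ?E"
    proof (rule image_subsetI)
      fix h assume "h \<in> ?spec"
      from spectrum_imp_eigenvalue[OF assms this] show "?pair h \<in> ?E"
        unfolding mem_Collect_eq case_prod_conv by (intro conjI)
    qed
  qed
  then show ?thesis
    unfolding polygon_spectral_curve_def thin_torus_spectral_curve_def torus_spectral_curve_def
    by (simp only: holonomy_eigenvalue_iff[OF assms])
qed

theorem theorem5p4:
  shows "(\<forall>(I :: real set) (\<gamma> :: int \<Rightarrow> hvec set) (\<eta> :: int \<Rightarrow> hvec set).
            is_interval I \<longrightarrow> polygon I \<gamma> \<longrightarrow> discrete_curve I \<eta> \<longrightarrow>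
            (curve_darboux I \<gamma> \<eta> \<longleftrightarrow> surface_darboux (thin_cylinder I) \<gamma> \<eta>)) \<and>
         (\<forall>(N :: nat) (\<gamma> :: int \<Rightarrow> hvec set).
            closed_polygon N \<gamma> \<longrightarrow>
            polygon_spectral_curve N \<gamma> = thin_torus_spectral_curve N \<gamma>)"
proof (intro conjI allI impI)
  fix I \<gamma> \<eta> assume "is_interval I" "polygon I \<gamma>" "discrete_curve I \<eta>"
  then show "curve_darboux I \<gamma> \<eta> \<longleftrightarrow> surface_darboux (thin_cylinder I) \<gamma> \<eta>"
    using curve_darboux_imp_surface_darboux surface_darboux_imp_curve_darboux by metis
qed (rule spectral_curves_coincide)

end
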